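(* Let $\tau\in\mathbb{C}$ with $\Im\tau>0$. The Weierstrass function $\wp(z)=\wp(z,\tau)$ with primitive periods $2$ and $2\tau$ verifies the following identities, for $\Im z<2\,\Im\tau$: $$\wp(z)-e_1=\frac{\left(\pi\cot\frac{\pi z}{2}\right)^2}{4}\prod_{k\ge1}\left[\frac{\cot\left(k\pi\tau-\frac{\pi z}{2}\right)\cot\left(k\pi\tau+\frac{\pi z}{2}\right)}{\left[\cot(k\pi\tau)\right]^2}\right]^2=\frac{\left(\pi^2\,\theta_3(0)\,\theta_4(0)\cot\frac{\pi z}{2}\right)^2}{4}\prod_{k\ge1}\left[\cot\left(k\pi\tau-\tfrac{\pi z}{2}\right)\cot\left(k\pi\tau+\tfrac{\pi z}{2}\right)\right]^2,$$ where $e_1=\wp(1)$. The two other infinite products are obtained by permuting the $e_i$: $$\wp(z)-e_3=\frac{\pi^2}{\left(2\sin\frac{\pi z}{2}\right)^2}\prod_{k\ge1}\left[\frac{\sin\left((k-\frac12)\pi\tau-\frac{\pi z}{2}\right)}{\sin\left(k\pi\tau-\frac{\pi z}{2}\right)}\cdot\frac{\sin\left((k-\frac12)\pi\tau+\frac{\pi z}{2}\right)}{\sin\left(k\pi\tau+\frac{\pi z}{2}\right)}\right]^2\left[\frac{\sin(k\pi\tau)}{\sin\left((k-\frac12)\pi\tau\right)}\right]^4,$$ $$\wp(z)-e_2=\frac{\pi^2}{\left(2\sin\frac{\pi z}{2}\right)^2}\prod_{k\ge1}\left[\frac{\cos\left((k-\frac12)\pi\tau-\frac{\pi z}{2}\right)}{\sin\left(k\pi\tau-\frac{\pi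 z}{2}\right)}\cdot\frac{\cos\left((k-\frac12)\pi\tau+\frac{\pi z}{2}\right)}{\sin\left(k\pi\tau+\frac{\pi z}{2}\right)}\right]^2\left[\frac{\sin(k\pi\tau)}{\cos\left((k-\frac12)\pi\tau\right)}\right]^4.$$
   Context: $\wp(z)=\wp(z,\tau)$ is the Weierstrass elliptic function of the lattice $2\mathbb{Z}+2\tau\mathbb{Z}$, and $e_1=\wp(1)$, $e_2=\wp(1+\tau)$, $e_3=\wp(\tau)$. $\theta_3(0)=\theta_3(0,\tau)=\sum_{m\in\mathbb{Z}}e^{i\pi\tau m^2}$ and $\theta_4(0)=\theta_4(0,\tau)=\sum_{m\in\mathbb{Z}}(-1)^m e^{i\pi\tau m^2}$ are the Jacobi theta constants. In the products for $\wp(z)-e_3$ and $\wp(z)-e_2$ every bracket written after $\prod_{k\ge1}$ belongs to the $k$-th factor.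
   Formalization: In the second expression for ℘(z)−e₁ the printed factor π²θ₃(0)θ₄(0) is corrected to πθ₃(0)θ₄(0) (the printed one is too large by π² whenever ℘(z)≠e₁); z is taken off the period lattice 2ℤ+2τℤ, where ℘ has its poles. *)

theory Defs
  imports "HOL-Analysis.Analysis"
begin

definition period_lattice :: "complex \<Rightarrow> complex set" where
  "period_lattice \<tau> = {2 * of_int m + 2 * of_int n * \<tau> | m n :: int. True}"

(* At lattice points, where the function has its poles, the value of wp is a junk value. *)
definition wp :: "complex \<Rightarrow> complex \<Rightarrow> complex" where
  "wp \<tau> z = 1 / z\<^sup>2 +
     (\<Sum>\<^sub>\<infinity>\<omega>\<in>period_lattice \<tau> - {0}. 1 / (z - \<omega>)\<^sup>2 - 1 / \<omega>\<^sup>2)"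

definition wp_e1 :: "complex \<Rightarrow> complex" where
  "wp_e1 \<tau> = wp \<tau> 1"

definition wp_e2 :: "complex \<Rightarrow> complex" where
  "wp_e2 \<tau> = wp \<tau> (1 + \<tau>)"

definition wp_e3 :: "complex \<Rightarrow> complex" where
  "wp_e3 \<tau> = wp \<tau> \<tau>"

definition theta3_0 :: "complex \<Rightarrow> complex" where
  "theta3_0 \<tau> = (\<Sum>\<^sub>\<infinity>m\<in>(UNIV :: int set). exp (\<i> * of_real pi * \<tau> * of_int m ^ 2))"

definition theta4_0 :: "complex \<Rightarrow> complex" where
  "theta4_0 \<tau> =
     (\<Sum>\<^sub>\<infinity>m\<in>(UNIV :: int set). (-1) powi m * exp (\<i> * of_real pi * \<tau> * of_int m ^ 2))"

(* The k-th factors (k >= 1) of the four infinite products, in the order of the theorem. *)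

definition factor_e1 :: "complex \<Rightarrow> complex \<Rightarrow> nat \<Rightarrow> complex" where
  "factor_e1 \<tau> z k =
     (cot (of_nat k * of_real pi * \<tau> - of_real pi * z / 2) *
      cot (of_nat k * of_real pi * \<tau> + of_real pi * z / 2) /
      (cot (of_nat k * of_real pi * \<tau>))\<^sup>2)\<^sup>2"

definition factor_e1_theta :: "complex \<Rightarrow> complex \<Rightarrow> nat \<Rightarrow> complex" where
  "factor_e1_theta \<tau> z k =
     (cot (of_nat k * of_real pi * \<tau> - of_real pi * z / 2) *
      cot (of_nat k * of_real pi * \<tau> + of_real pi * z / 2))\<^sup>2"

definition factor_e3 :: "complex \<Rightarrow> complex \<Rightarrow> nat \<Rightarrow> complex" where
  "factor_e3 \<tau> z k =
     (sin ((of_nat k - 1/2) * of_real pi * \<tau> - of_real pi * z / 2) /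
      sin (of_nat k * of_real pi * \<tau> - of_real pi * z / 2) *
      (sin ((of_nat k - 1/2) * of_real pi * \<tau> + of_real pi * z / 2) /
       sin (of_nat k * of_real pi * \<tau> + of_real pi * z / 2)))\<^sup>2 *
     (sin (of_nat k * of_real pi * \<tau>) / sin ((of_nat k - 1/2) * of_real pi * \<tau>)) ^ 4"

definition factor_e2 :: "complex \<Rightarrow> complex \<Rightarrow> nat \<Rightarrow> complex" where
  "factor_e2 \<tau> z k =
     (cos ((of_nat k - 1/2) * of_real pi * \<tau> - of_real pi * z / 2) /
      sin (of_nat k * of_real pi * \<tau> - of_real pi * z / 2) *
      (cos ((of_nat k - 1/2) * of_real pi * \<tau> + of_real pi * z / 2) /
       sin (of_nat k * of_real pi * \<tau> + of_real pi * z / 2)))\<^sup>2 *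
     (sin (of_nat k * of_real pi * \<tau>) / cos ((of_nat k - 1/2) * of_real pi * \<tau>)) ^ 4"

(* The theorem has the constant pi * theta3(0) * theta4(0) in front of the product of the
   factor_e1_theta. The source prints pi^2 there, which is a misprint: since the product
   over k >= 1 of cot(k pi tau)^4 is 1 / (theta3(0) theta4(0))^2, only the first power of pi
   gives the principal part 1 / z^2 at z = 0. *)

end

theory Submission
  imports Defs "HOL-Complex_Analysis.Complex_Analysis" "HOL-Real_Asymp.Real_Asymp"
begin

text \<open>
  Each of the three products, taken with the elementary function in front of it, is even and elliptic
  in \<open>z\<close> with periods \<open>2\<close> and \<open>2 \<tau>\<close>, and has its poles exactly at the lattice points, with leading
  term \<open>1 / z\<^sup>2\<close> at the origin. The
  Weierstrass function has the same properties, so the difference of the two is constant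
  (\<open>even_elliptic_constant\<close>, a form of Liouville's theorem). The constant is found at a half-period
  where the product visibly vanishes, and it is \<open>e\<^sub>1\<close>, \<open>e\<^sub>2\<close> or \<open>e\<^sub>3\<close>.

  On the side of \<open>wp\<close>, everything follows from the absolutely convergent lattice sum; the periods are
  obtained by summing the difference of two translates row by row (\<open>wp_add_period\<close>).

  On the side of the products, put \<open>w = exp (\<i> \<pi> z)\<close>, \<open>q = exp (\<i> \<pi> \<tau>)\<close> and \<open>p = q\<^sup>2\<close>. Written in
  exponentials, sines, cosines and cotangents turn all factors into factors \<open>1 + p\<^sup>k x\<close>, where \<open>x\<close> is
  \<open>s w\<close> or \<open>s / w\<close> with \<open>s\<close> among \<open>\<plusminus> 1\<close>, \<open>\<plusminus> 1 / q\<close>, or such an \<open>s\<close> itself in the normalising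
  factors. All three products are thus given by the same normalised square of a quotient of theta
  functions (\<open>theta_quotient\<close>) for \<open>s = 1\<close>, \<open>- 1 / q\<close> and \<open>1 / q\<close>. The
  functional equation \<open>qpoch p x = (1 + p x) qpoch p (p x)\<close> shows that this quotient, multiplied by
  the elementary factor in front of the product, is invariant under \<open>w \<mapsto> p w\<close>, that is, under
  \<open>z \<mapsto> z + 2 \<tau>\<close>; the other properties are immediate.

  The version with theta constants follows from the first identity and the evaluation
  \<open>\<theta>\<^sub>3(0) \<theta>\<^sub>4(0) = \<Prod> ((1 - p\<^sup>k) / (1 + p\<^sup>k))\<^sup>2\<close> (\<open>theta_product\<close>). It comes from the Jacobi triple
  product, obtained here as a limit of its finite form, and Euler's identity.
\<close>

section \<open>The period lattice\<close>

lemma zero_in_period_lattice [simp]: "0 \<in> period_lattice \<tau>"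
  unfolding period_lattice_def by (rule CollectI, rule exI[of _ 0], rule exI[of _ 0]) auto

lemma period_lattice_add:
  assumes "x \<in> period_lattice \<tau>" "y \<in> period_lattice \<tau>"
  shows "x + y \<in> period_lattice \<tau>"
proof -
  obtain m n m' n' :: int where "x = 2 * of_int m + 2 * of_int n * \<tau>" "y = 2 * of_int m' + 2 * of_int n' * \<tau>"
    using assms by (auto simp: period_lattice_def)
  hence "x + y = 2 * of_int (m + m') + 2 * of_int (n + n') * \<tau>"
    by (simp add: algebra_simps)
  thus ?thesis unfolding period_lattice_def by blast
qed

lemma period_lattice_minus:
  assumes "x \<in> period_lattice \<tau>"
  shows "-x \<in> period_lattice \<tau>"
proof -
  obtain m n :: int where "x = 2 * of_int m + 2 * of_int n * \<tau>"
    using assms by (auto simp: period_lattice_def)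
  hence "-x = 2 * of_int (-m) + 2 * of_int (-n) * \<tau>"
    by (simp add: algebra_simps)
  thus ?thesis unfolding period_lattice_def by blast
qed

lemma period_lattice_minus_iff [simp]: "-x \<in> period_lattice \<tau> \<longleftrightarrow> x \<in> period_lattice \<tau>"
  using period_lattice_minus[of x] period_lattice_minus[of "-x"] by auto

lemma period_lattice_diff:
  "x \<in> period_lattice \<tau> \<Longrightarrow> y \<in> period_lattice \<tau> \<Longrightarrow> x - y \<in> period_lattice \<tau>"
  using period_lattice_add[of x \<tau> "-y"] by simp

lemma period_lattice_add_cancel:
  assumes "x \<in> period_lattice \<tau>"
  shows "z + x \<in> period_lattice \<tau> \<longleftrightarrow> z \<in> period_lattice \<tau>"
  using assms period_lattice_add[of z \<tau> x] period_lattice_diff[of "z + x" \<tau> x] by auto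

lemma periods_in_period_lattice [simp]:
  "2 \<in> period_lattice \<tau>" "2 * \<tau> \<in> period_lattice \<tau>"
proof -
  have "2 = 2 * of_int 1 + 2 * of_int 0 * \<tau>" "2 * \<tau> = 2 * of_int 0 + 2 * of_int 1 * \<tau>"
    by auto
  thus "2 \<in> period_lattice \<tau>" "2 * \<tau> \<in> period_lattice \<tau>"
    unfolding period_lattice_def by blast+
qed

text \<open>
  The imaginary part of a lattice point determines the coefficient of \<open>\<tau>\<close> up to the factor \<open>Im \<tau>\<close>, and
  subtracting that multiple of \<open>\<tau>\<close> bounds the other coefficient. Discreteness of the lattice and
  the convergence of all sums over it rest on this estimate.
\<close>
lemma period_lattice_coords_bound:
  assumes "Im \<tau> > 0"
  obtains K :: real where "K > 0"
    "\<And>m n :: int. real_of_int (\<bar>m\<bar> + \<bar>n\<bar>) \<le> K * norm (2 * of_int m + 2 * of_int n * \<tau>)"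
proof
  define K where "K = 1 + (1 + norm \<tau>) / Im \<tau>"
  show "K > 0" unfolding K_def using assms by (simp add: add_pos_nonneg)
  fix m n :: int
  define \<omega> where "\<omega> = of_int m + of_int n * \<tau>"
  have n: "\<bar>of_int n\<bar> \<le> norm \<omega> / Im \<tau>"
    using assms abs_Im_le_cmod[of \<omega>] by (simp add: \<omega>_def field_simps abs_mult)
  have "\<bar>of_int m\<bar> = norm (\<omega> - of_int n * \<tau>)"
    by (simp add: \<omega>_def)
  also have "\<dots> \<le> norm \<omega> + \<bar>of_int n\<bar> * norm \<tau>"
    by (rule order_trans[OF norm_triangle_ineq4]) (simp add: norm_mult)
  also have "\<dots> \<le> norm \<omega> + norm \<omega> / Im \<tau> * norm \<tau>"
    using n by (intro add_left_mono mult_right_mono) auto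
  finally have "real_of_int (\<bar>m\<bar> + \<bar>n\<bar>) \<le> K * norm \<omega>"
    using n by (simp add: K_def add_divide_distrib distrib_left distrib_right mult.commute)
  also have "\<dots> \<le> K * norm (2 * \<omega>)"
    using \<open>K > 0\<close> by (simp add: norm_mult)
  finally show "real_of_int (\<bar>m\<bar> + \<bar>n\<bar>) \<le> K * norm (2 * of_int m + 2 * of_int n * \<tau>)"
    by (simp add: \<omega>_def algebra_simps)
qed

lemma period_lattice_bij_betw:
  assumes "Im \<tau> > 0"
  shows "bij_betw (\<lambda>(m, n). 2 * of_int m + 2 * of_int n * \<tau>) (UNIV :: (int \<times> int) set) (period_lattice \<tau>)"
proof -
  have "m = m' \<and> n = n'"
    if "2 * of_int m + 2 * of_int n * \<tau> = 2 * of_int m' + 2 * of_int n' * \<tau>" for m n m' n' :: int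
  proof -
    have "Im (2 * of_int m + 2 * of_int n * \<tau>) = Im (2 * of_int m' + 2 * of_int n' * \<tau>)"
      using that by (rule arg_cong)
    hence "n = n'" using assms by simp
    thus ?thesis using that by simp
  qed
  thus ?thesis
    by (auto simp: bij_betw_def inj_on_def period_lattice_def)
qed

lemma period_lattice_finite_ball:
  assumes "Im \<tau> > 0"
  shows "finite {\<omega> \<in> period_lattice \<tau>. norm \<omega> < R}"
proof -
  obtain K where K: "K > 0"
    "\<And>m n :: int. real_of_int (\<bar>m\<bar> + \<bar>n\<bar>) \<le> K * norm (2 * of_int m + 2 * of_int n * \<tau>)"
    using period_lattice_coords_bound[OF assms] by blast
  define N where "N = \<lceil>K * R\<rceil>"
  have "{\<omega> \<in> period_lattice \<tau>. norm \<omega> < R} \<subseteq>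
          (\<lambda>(m, n). 2 * of_int m + 2 * of_int n * \<tau>) ` ({-N..N} \<times> {-N..N})"
  proof
    fix \<omega> assume "\<omega> \<in> {\<omega> \<in> period_lattice \<tau>. norm \<omega> < R}"
    then obtain m n :: int where \<omega>: "\<omega> = 2 * of_int m + 2 * of_int n * \<tau>" "norm \<omega> < R"
      by (auto simp: period_lattice_def)
    have "real_of_int (\<bar>m\<bar> + \<bar>n\<bar>) \<le> K * R"
      using K(2)[of m n] \<omega> K(1) by (smt (verit) mult_left_mono)
    hence "\<bar>m\<bar> + \<bar>n\<bar> \<le> N" unfolding N_def by linarith
    hence "(m, n) \<in> {-N..N} \<times> {-N..N}" by auto
    thus "\<omega> \<in> (\<lambda>(m, n). 2 * of_int m + 2 * of_int n * \<tau>) ` ({-N..N} \<times> {-N..N})"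
      using \<omega> by (intro image_eqI[of _ _ "(m, n)"]) auto
  qed
  thus ?thesis by (rule finite_subset) auto
qed

lemma period_lattice_gap:
  assumes "Im \<tau> > 0"
  obtains \<epsilon> :: real where "\<epsilon> > 0" "\<And>\<omega>. \<omega> \<in> period_lattice \<tau> \<Longrightarrow> norm \<omega> < \<epsilon> \<Longrightarrow> \<omega> = 0"
proof -
  obtain K where K: "K > 0"
    "\<And>m n :: int. real_of_int (\<bar>m\<bar> + \<bar>n\<bar>) \<le> K * norm (2 * of_int m + 2 * of_int n * \<tau>)"
    using period_lattice_coords_bound[OF assms] by blast
  show ?thesis
  proof (rule that[of "1 / K"])
    fix \<omega> assume "\<omega> \<in> period_lattice \<tau>" and small: "norm \<omega> < 1 / K"
    then obtain m n :: int where \<omega>: "\<omega> = 2 * of_int m + 2 * of_int n * \<tau>"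
      by (auto simp: period_lattice_def)
    have "real_of_int (\<bar>m\<bar> + \<bar>n\<bar>) < 1"
      using K(2)[of m n] small K(1) by (simp add: \<omega> field_simps)
    hence "m = 0 \<and> n = 0" by linarith
    thus "\<omega> = 0" by (simp add: \<omega>)
  qed (use K in auto)
qed

lemma closed_period_lattice:
  assumes "Im \<tau> > 0"
  shows "closed (period_lattice \<tau>)"
proof -
  obtain \<epsilon> where \<epsilon>: "\<epsilon> > 0" "\<And>\<omega>. \<omega> \<in> period_lattice \<tau> \<Longrightarrow> norm \<omega> < \<epsilon> \<Longrightarrow> \<omega> = 0"
    using period_lattice_gap[OF assms] by blast
  show ?thesis
  proof (rule discrete_imp_closed[OF \<epsilon>(1)], intro ballI impI)
    fix x y assume "x \<in> period_lattice \<tau>" "y \<in> period_lattice \<tau>" "dist y x < \<epsilon>"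
    thus "y = x" using \<epsilon>(2)[of "y - x"] period_lattice_diff[of y \<tau> x] by (simp add: dist_norm)
  qed
qed

section \<open>Even elliptic functions\<close>

text \<open>
  The two period relations are only assumed off the lattice, because at lattice points the functions
  of interest have junk values; the lattice is invariant under translation by its own points, so the
  induction never leaves the set where the relations hold.
\<close>
lemma periodic_add_lattice:
  assumes per: "\<And>z. z \<notin> period_lattice \<tau> \<Longrightarrow> f (z + 2) = f z"
               "\<And>z. z \<notin> period_lattice \<tau> \<Longrightarrow> f (z + 2 * \<tau>) = f z"
    and \<omega>: "\<omega> \<in> period_lattice \<tau>" and z: "z \<notin> period_lattice \<tau>"
  shows "f (z + \<omega>) = (f z :: 'a)"
proof -
  obtain m n :: int where mn: "\<omega> = 2 * of_int m + 2 * of_int n * \<tau>"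
    using \<omega> by (auto simp: period_lattice_def)
  have step: "f (z + of_int m * x) = f z"
    if "\<And>z. z \<notin> period_lattice \<tau> \<Longrightarrow> f (z + x) = f z" "x \<in> period_lattice \<tau>" "z \<notin> period_lattice \<tau>"
    for x z and m :: int
  proof (induction m rule: int_induct[of _ 0])
    case base
    show ?case by simp
  next
    case (step1 i)
    have "of_int i * x \<in> period_lattice \<tau>"
      using step1.hyps
      by (induction i rule: int_ge_induct) (auto simp: algebra_simps intro: period_lattice_add that)
    hence "z + of_int i * x \<notin> period_lattice \<tau>"
      using that by (simp add: period_lattice_add_cancel)
    from that(1)[OF this] step1.IH show ?case by (simp add: algebra_simps)
  next
    case (step2 i)
    have "of_int (i - 1) * x \<in> period_lattice \<tau>"
      using step2.hyps
      by (induction i rule: int_le_induct)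
         (auto simp: algebra_simps dest: period_lattice_diff[OF _ that(2)] intro: that(2))
    hence "z + of_int (i - 1) * x \<notin> period_lattice \<tau>"
      using that by (simp only: period_lattice_add_cancel not_False_eq_True)
    from that(1)[OF this] step2.IH show ?case by (simp add: algebra_simps)
  qed
  have l: "of_int m * 2 \<in> period_lattice \<tau>"
    unfolding period_lattice_def by (rule CollectI, rule exI[of _ m], rule exI[of _ 0]) auto
  have "f (z + \<omega>) = f ((z + of_int m * 2) + of_int n * (2 * \<tau>))"
    by (simp add: mn algebra_simps)
  also have "\<dots> = f (z + of_int m * 2)"
    using l z by (intro step per) (auto simp: period_lattice_add_cancel)
  also have "\<dots> = f z"
    using z by (intro step per) auto
  finally show ?thesis .
qed

lemma period_parallelogram_representative:
  assumes "Im \<tau> > 0"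
  obtains s t :: real and \<omega> where "s \<in> {0..1}" "t \<in> {0..1}" "\<omega> \<in> period_lattice \<tau>"
    "z = 2 * of_real s + 2 * of_real t * \<tau> + \<omega>"
proof -
  define b where "b = Im z / (2 * Im \<tau>)"
  define a where "a = Re z / 2 - b * Re \<tau>"
  have z: "z = 2 * of_real a + 2 * of_real b * \<tau>"
    using assms by (simp add: complex_eq_iff a_def b_def)
  show ?thesis
  proof (rule that[of "frac a" "frac b" "2 * of_int \<lfloor>a\<rfloor> + 2 * of_int \<lfloor>b\<rfloor> * \<tau>"])
    show "frac a \<in> {0..1}" "frac b \<in> {0..1}"
      using frac_lt_1[of a] frac_lt_1[of b] by (auto intro: less_imp_le)
    show "2 * of_int \<lfloor>a\<rfloor> + 2 * of_int \<lfloor>b\<rfloor> * \<tau> \<in> period_lattice \<tau>"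
      unfolding period_lattice_def by blast
    show "z = 2 * of_real (frac a) + 2 * of_real (frac b) * \<tau> + (2 * of_int \<lfloor>a\<rfloor> + 2 * of_int \<lfloor>b\<rfloor> * \<tau>)"
      by (subst z) (simp add: frac_def algebra_simps)
  qed
qed

text \<open>
  The hypothesis on the limit leaves at most a simple pole at the origin, and evenness excludes that
  pole too: \<open>z\<^sup>2 f z\<close> extends to an even function vanishing at the origin, whose derivative there
  is therefore zero. Periodicity removes the singularities at all lattice points at once, and the
  resulting entire function takes all its values on one compact parallelogram, so it is constant by
  Liouville's theorem. For even functions with double poles at the lattice points, equality up to a
  constant thus reduces to equality of the leading terms at the origin.
\<close>
lemma even_elliptic_constant:
  assumes \<tau>: "Im \<tau> > 0"
    and holo: "f holomorphic_on (- period_lattice \<tau>)"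
    and per: "\<And>z. z \<notin> period_lattice \<tau> \<Longrightarrow> f (z + 2) = f z"
             "\<And>z. z \<notin> period_lattice \<tau> \<Longrightarrow> f (z + 2 * \<tau>) = f z"
    and even: "\<And>z. z \<notin> period_lattice \<tau> \<Longrightarrow> f (- z) = f z"
    and lim: "(\<lambda>z. z\<^sup>2 * f z) \<midarrow>0\<rightarrow> 0"
    and z: "z \<notin> period_lattice \<tau>" and w: "w \<notin> period_lattice \<tau>"
  shows "f z = f w"
proof -
  let ?L = "period_lattice \<tau>"
  obtain \<epsilon> where \<epsilon>: "\<epsilon> > 0" "\<And>\<omega>. \<omega> \<in> ?L \<Longrightarrow> norm \<omega> < \<epsilon> \<Longrightarrow> \<omega> = 0"
    using period_lattice_gap[OF \<tau>] by blast
  have sub: "ball 0 \<epsilon> - {0} \<subseteq> - ?L" using \<epsilon>(2) by auto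
  have holo': "f holomorphic_on (ball 0 \<epsilon> - {0})"
    using holo sub by (rule holomorphic_on_subset)
  define u where "u = (\<lambda>z. if z = 0 then 0 else z\<^sup>2 * f z)"
  have u_holo: "u holomorphic_on ball 0 \<epsilon>"
    unfolding u_def
    by (rule removable_singularity) (use lim in \<open>auto intro!: holomorphic_intros holo'\<close>)
  have u_even: "u (- z) = u z" if "z \<in> ball 0 \<epsilon>" for z
    using that sub even[of z] by (auto simp: u_def)
  have "deriv u 0 = 0"
  proof -
    have "(u has_field_derivative deriv u 0) (at 0)"
      using u_holo \<epsilon>(1) by (intro holomorphic_derivI[of u "ball 0 \<epsilon>"]) auto
    moreover from this have "((\<lambda>z. u (- z)) has_field_derivative (deriv u 0 * (-1))) (at 0)"
      by (intro DERIV_chain2[of u _ "\<lambda>z. - z" 0 "-1" UNIV]) (auto intro!: derivative_eq_intros)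
    moreover have "eventually (\<lambda>z. u (- z) = u z) (nhds 0)"
      by (rule eventually_mono[OF eventually_nhds_in_open[of "ball 0 \<epsilon>"]])
         (use \<epsilon>(1) u_even in auto)
    ultimately have "(u has_field_derivative (deriv u 0 * (-1))) (at 0)"
      by (subst (asm) DERIV_cong_ev[OF refl _ refl]) auto
    with \<open>(u has_field_derivative deriv u 0) (at 0)\<close> have "deriv u 0 = deriv u 0 * (-1)"
      by (rule DERIV_unique)
    thus ?thesis by simp
  qed
  define u1 where "u1 = (\<lambda>z. if z = 0 then deriv u 0 else (u z - u 0) / (z - 0))"
  have u1_holo: "u1 holomorphic_on ball 0 \<epsilon>"
    unfolding u1_def by (rule pole_lemma_open[OF u_holo]) auto
  have "isCont u1 0"
    using u1_holo \<epsilon>(1) by (metis holomorphic_on_imp_continuous_on continuous_on_eq_continuous_at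
        open_ball centre_in_ball)
  hence "u1 \<midarrow>0\<rightarrow> 0"
    using \<open>deriv u 0 = 0\<close> by (simp add: isCont_def u1_def)
  hence "(\<lambda>z. (z - 0) * f z) \<midarrow>0\<rightarrow> 0"
    by (rule Lim_transform_eventually)
       (auto simp: u1_def u_def power2_eq_square eventually_at intro!: exI[of _ 1])
  hence "\<exists>g. g holomorphic_on ball 0 \<epsilon> \<and> (\<forall>z\<in>ball 0 \<epsilon> - {0}. g z = f z)"
    using \<epsilon>(1) by (subst holomorphic_on_extend_lim[OF holo']) auto
  then obtain g where g: "g holomorphic_on ball 0 \<epsilon>" "\<And>z. z \<in> ball 0 \<epsilon> - {0} \<Longrightarrow> g z = f z"
    by blast
  define F where "F = (\<lambda>z. if z \<in> ?L then g 0 else f z)"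
  have F_per: "F (z + \<omega>) = F z" if "\<omega> \<in> ?L" for z \<omega>
    using that periodic_add_lattice[of \<tau> f \<omega> z] per by (auto simp: F_def period_lattice_add_cancel)
  have F_ball: "F z = g z" if "z \<in> ball 0 \<epsilon>" for z
    using that \<epsilon>(2)[of z] g(2)[of z] by (cases "z = 0") (auto simp: F_def)
  have "F field_differentiable at z" for z
  proof (cases "z \<in> ?L")
    case False
    have "F holomorphic_on (- ?L)"
      using holo by (rule holomorphic_transform) (auto simp: F_def)
    thus ?thesis
      using False closed_period_lattice[OF \<tau>]
      by (auto intro!: holomorphic_on_imp_differentiable_at[of F "- ?L"])
  next
    case True
    have "F y = g (y - z)" if "y \<in> ball z \<epsilon>" for y
    proof -
      have "F y = F (y - z)" using F_per[OF True, of "y - z"] by simp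
      thus ?thesis using that by (simp add: F_ball dist_norm norm_minus_commute)
    qed
    moreover have "(\<lambda>y. g (y - z)) holomorphic_on ball z \<epsilon>"
      by (rule holomorphic_on_compose_gen[of "\<lambda>y. y - z" "ball z \<epsilon>" g "ball 0 \<epsilon>", unfolded o_def])
         (auto simp: dist_norm norm_minus_commute intro!: holomorphic_intros g(1))
    ultimately have "F holomorphic_on ball z \<epsilon>"
      by (subst holomorphic_cong[OF refl]) auto
    thus ?thesis using \<epsilon>(1) by (auto intro!: holomorphic_on_imp_differentiable_at[of F "ball z \<epsilon>"])
  qed
  hence F_holo: "F holomorphic_on UNIV"
    by (simp add: holomorphic_on_def)
  define P where "P = (\<lambda>(s, t). 2 * complex_of_real s + 2 * of_real t * \<tau>) ` ({0..1} \<times> {0..1})"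
  have "compact P" unfolding P_def case_prod_unfold
    by (intro compact_continuous_image compact_Times continuous_intros) auto
  moreover have "range F \<subseteq> F ` P"
  proof
    fix y assume "y \<in> range F"
    then obtain z where y: "y = F z" by auto
    obtain s t \<omega> where st: "s \<in> {0..1}" "t \<in> {0..1}" "\<omega> \<in> ?L" "z = 2 * of_real s + 2 * of_real t * \<tau> + \<omega>"
      using period_parallelogram_representative[OF \<tau>] by blast
    have "y = F (2 * of_real s + 2 * of_real t * \<tau>)"
      using y st(3,4) F_per by simp
    moreover have "2 * of_real s + 2 * of_real t * \<tau> \<in> P"
      unfolding P_def using st(1,2) by (intro image_eqI[of _ _ "(s, t)"]) auto
    ultimately show "y \<in> F ` P" by blast
  qed
  ultimately have "bounded (range F)"
    using F_holo by (meson bounded_subset compact_continuous_image compact_imp_bounded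
        continuous_on_subset holomorphic_on_imp_continuous_on top_greatest)
  then obtain c where "\<And>z. F z = c"
    using Liouville_theorem[OF F_holo] by (auto simp: constant_on_def)
  hence "F z = F w" by simp
  thus ?thesis using z w by (simp add: F_def)
qed

section \<open>The Weierstrass function\<close>

lemma summable_on_int_abs:
  fixes g :: "nat \<Rightarrow> real"
  assumes "summable g" "\<And>n. g n \<ge> 0"
  shows "(\<lambda>m :: int. g (nat \<bar>m\<bar>)) summable_on UNIV"
proof -
  have g: "g summable_on UNIV"
    using assms by (simp add: summable_on_UNIV_nonneg_real_iff)
  have "(\<lambda>m. g (nat \<bar>m\<bar>)) summable_on range int"
    by (subst summable_on_reindex) (use g in \<open>auto simp: o_def\<close>)
  moreover have "(\<lambda>m. g (nat \<bar>m\<bar>)) summable_on range (\<lambda>n. - int n)"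
    by (subst summable_on_reindex) (use g in \<open>auto simp: o_def inj_on_def\<close>)
  ultimately have "(\<lambda>m. g (nat \<bar>m\<bar>)) summable_on (range int \<union> range (\<lambda>n. - int n))"
    by (rule summable_on_union)
  also have "range int \<union> range (\<lambda>n. - int n) = UNIV"
  proof -
    have "m \<in> range int \<union> range (\<lambda>n. - int n)" for m
      by (cases m rule: int_cases2) auto
    thus ?thesis by auto
  qed
  finally show ?thesis .
qed

lemma summable_powr_int:
  assumes "a > (1 :: real)"
  shows "(\<lambda>m :: int. (1 + real_of_int \<bar>m\<bar>) powr (- a)) summable_on UNIV"
proof -
  have "summable (\<lambda>n. real (Suc n) powr (- a))"
    using assms by (subst summable_Suc_iff) (simp add: summable_real_powr_iff)
  hence "(\<lambda>m :: int. real (Suc (nat \<bar>m\<bar>)) powr (- a)) summable_on UNIV"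
    by (intro summable_on_int_abs[of "\<lambda>n. real (Suc n) powr (- a)"]) auto
  thus ?thesis by (simp add: add.commute)
qed

text \<open>
  At nonzero lattice points \<open>1 + \<bar>m\<bar>\<close> and \<open>1 + \<bar>n\<bar>\<close> are both at most a constant times the
  norm of \<open>2 m + 2 n \<tau>\<close>, so the cube of that norm dominates the product of their powers with exponent
  \<open>3/2\<close>. This reduces the double series to a product of two convergent series.
\<close>
lemma summable_on_period_lattice_cube:
  assumes "Im \<tau> > 0"
  shows "(\<lambda>\<omega>. 1 / norm \<omega> ^ 3) summable_on period_lattice \<tau>"
proof -
  obtain K where K: "K > 0"
    "\<And>m n :: int. real_of_int (\<bar>m\<bar> + \<bar>n\<bar>) \<le> K * norm (2 * of_int m + 2 * of_int n * \<tau>)"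
    using period_lattice_coords_bound[OF assms] by blast
  let ?f = "\<lambda>m :: int. (1 + real_of_int \<bar>m\<bar>) powr (- (3/2))"
  have "(\<lambda>(m, n). ?f m * ?f n) summable_on (UNIV \<times> UNIV)"
    using summable_powr_int[of "3/2"]
    by (intro summable_on_SigmaI[where g = "\<lambda>m. ?f m * infsum ?f UNIV"])
       (auto intro!: has_sum_cmult_right summable_on_cmult_left)
  hence "(\<lambda>x. (8 * K ^ 3) * (case x of (m, n) \<Rightarrow> ?f m * ?f n)) summable_on UNIV"
    by (intro summable_on_cmult_right) auto
  hence "(\<lambda>x. norm (1 / norm ((\<lambda>(m, n). 2 * of_int m + 2 * of_int n * \<tau>) x) ^ 3)) summable_on UNIV"
  proof (rule Infinite_Sum.abs_summable_on_comparison_test')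
    fix x :: "int \<times> int"
    obtain m n where x: "x = (m, n)" by (cases x)
    define \<omega> where "\<omega> = 2 * of_int m + 2 * of_int n * \<tau>"
    define M where "M = 1 + real_of_int \<bar>m\<bar>"
    define N where "N = 1 + real_of_int \<bar>n\<bar>"
    have MN: "M \<ge> 1" "N \<ge> 1" by (auto simp: M_def N_def)
    have "1 / norm \<omega> ^ 3 \<le> 8 * K ^ 3 * (M powr (- (3/2)) * N powr (- (3/2)))"
    proof (cases "m = 0 \<and> n = 0")
      case True
      thus ?thesis using K(1) by (simp add: \<omega>_def)
    next
      case False
      hence "1 \<le> real_of_int (\<bar>m\<bar> + \<bar>n\<bar>)" by linarith
      hence le: "M \<le> 2 * (K * norm \<omega>)" "N \<le> 2 * (K * norm \<omega>)"
        using K(2)[of m n] unfolding M_def N_def \<omega>_def by linarith+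
      hence pos: "norm \<omega> > 0"
        using K(1) MN by (smt (verit) zero_less_mult_pos)
      have "M powr (3/2) * N powr (3/2) \<le> (2 * (K * norm \<omega>)) powr (3/2) * (2 * (K * norm \<omega>)) powr (3/2)"
        using le MN by (intro mult_mono powr_mono2) auto
      also have "\<dots> = (2 * (K * norm \<omega>)) powr 3"
        by (simp flip: powr_add)
      also have "\<dots> = 8 * K ^ 3 * norm \<omega> ^ 3"
        using K(1) pos by (simp add: powr_numeral power_mult_distrib)
      finally have "M powr (3/2) * N powr (3/2) \<le> 8 * K ^ 3 * norm \<omega> ^ 3" .
      thus ?thesis using pos MN by (simp add: powr_minus field_simps)
    qed
    thus "norm (1 / norm ((\<lambda>(m, n). 2 * of_int m + 2 * of_int n * \<tau>) x) ^ 3) \<le>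
            8 * K ^ 3 * (case x of (m, n) \<Rightarrow> ?f m * ?f n)"
      by (simp add: x \<omega>_def M_def N_def)
  qed
  hence "(\<lambda>x. 1 / norm ((\<lambda>(m, n). 2 * of_int m + 2 * of_int n * \<tau>) x) ^ 3) summable_on (UNIV :: (int \<times> int) set)"
    by simp
  thus ?thesis
    by (subst (asm) summable_on_reindex_bij_betw[OF period_lattice_bij_betw[OF assms], of "\<lambda>\<omega>. 1 / norm \<omega> ^ 3"])
qed

lemma wp_term_bound:
  assumes "norm z \<le> R" "2 * R \<le> norm \<omega>" "\<omega> \<noteq> 0"
  shows "norm (1 / (z - \<omega>)\<^sup>2 - 1 / \<omega>\<^sup>2) \<le> 10 * R * (1 / norm (\<omega> :: complex) ^ 3)"
proof -
  have pos: "norm \<omega> > 0" using assms by simp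
  have R: "R \<ge> 0" using assms(1) norm_ge_zero order_trans by blast
  have half: "norm \<omega> / 2 \<le> norm (z - \<omega>)"
    using norm_triangle_ineq2[of \<omega> z] assms by (simp add: norm_minus_commute)
  hence nz: "z \<noteq> \<omega>" using pos by auto
  have "1 / (z - \<omega>)\<^sup>2 - 1 / \<omega>\<^sup>2 = z * (2 * \<omega> - z) / (\<omega>\<^sup>2 * (z - \<omega>)\<^sup>2)"
    using nz assms(3) by (simp add: field_simps) (simp add: power2_eq_square algebra_simps)
  also have "norm \<dots> = norm z * norm (2 * \<omega> - z) / (norm \<omega> ^ 2 * norm (z - \<omega>) ^ 2)"
    by (simp add: norm_mult norm_divide norm_power)
  \<comment> \<open>both bounds use \<open>norm z \<le> norm \<omega> / 2\<close>\<close>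
  also have "\<dots> \<le> R * (5 / 2 * norm \<omega>) / (norm \<omega> ^ 2 * (norm \<omega> / 2) ^ 2)"
  proof (intro frac_le mult_mono power_mono mult_left_mono half)
    show "norm (2 * \<omega> - z) \<le> 5 / 2 * norm \<omega>"
      using norm_triangle_ineq4[of "2 * \<omega>" z] assms by (simp add: norm_mult)
  qed (use pos R assms in auto)
  also have "\<dots> = 10 * R * (1 / norm \<omega> ^ 3)"
    using pos by (simp add: field_simps power2_eq_square power3_eq_cube)
  finally show ?thesis .
qed

lemma wp_tail_summable:
  assumes "Im \<tau> > 0" "R > 0" "norm z \<le> R"
  shows "(\<lambda>\<omega>. 1 / (z - \<omega>)\<^sup>2 - 1 / \<omega>\<^sup>2) summable_on {\<omega> \<in> period_lattice \<tau>. 2 * R \<le> norm \<omega>}"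
proof -
  have "(\<lambda>\<omega>. 10 * R * (1 / norm \<omega> ^ 3)) summable_on {\<omega> \<in> period_lattice \<tau>. 2 * R \<le> norm \<omega>}"
    by (rule summable_on_cmult_right, rule summable_on_subset[OF summable_on_period_lattice_cube[OF assms(1)]]) auto
  hence "(\<lambda>\<omega>. norm (1 / (z - \<omega>)\<^sup>2 - 1 / \<omega>\<^sup>2)) summable_on {\<omega> \<in> period_lattice \<tau>. 2 * R \<le> norm \<omega>}"
    by (rule Infinite_Sum.abs_summable_on_comparison_test', intro wp_term_bound) (use assms in auto)
  thus ?thesis by (rule abs_summable_summable)
qed

lemma period_lattice_split:
  "period_lattice \<tau> = {\<omega> \<in> period_lattice \<tau>. norm \<omega> < R} \<union> {\<omega> \<in> period_lattice \<tau>. R \<le> norm \<omega>}"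
  by auto

lemma wp_summable:
  assumes "Im \<tau> > 0"
  shows "(\<lambda>\<omega>. 1 / (z - \<omega>)\<^sup>2 - 1 / \<omega>\<^sup>2) summable_on period_lattice \<tau>"
proof (subst period_lattice_split[of \<tau> "2 * (norm z + 1)"], rule summable_on_union)
  show "(\<lambda>\<omega>. 1 / (z - \<omega>)\<^sup>2 - 1 / \<omega>\<^sup>2) summable_on {\<omega> \<in> period_lattice \<tau>. norm \<omega> < 2 * (norm z + 1)}"
    by (intro summable_on_finite period_lattice_finite_ball assms)
  show "(\<lambda>\<omega>. 1 / (z - \<omega>)\<^sup>2 - 1 / \<omega>\<^sup>2) summable_on {\<omega> \<in> period_lattice \<tau>. 2 * (norm z + 1) \<le> norm \<omega>}"
    by (intro wp_tail_summable assms) (auto intro: add_nonneg_pos)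
qed

text \<open>
  Since \<open>1 / 0 = 0\<close>, the term of the sum at the lattice point \<open>0\<close> is \<open>1 / z\<^sup>2\<close>. Treating all lattice
  points alike makes the sum accessible to reindexing by symmetries and translations of the lattice.
\<close>
lemma wp_eq:
  assumes "Im \<tau> > 0"
  shows "wp \<tau> z = (\<Sum>\<^sub>\<infinity>\<omega>\<in>period_lattice \<tau>. 1 / (z - \<omega>)\<^sup>2 - 1 / \<omega>\<^sup>2)"
proof -
  have "(\<lambda>\<omega>. 1 / (z - \<omega>)\<^sup>2 - 1 / \<omega>\<^sup>2) summable_on period_lattice \<tau> - {0}"
    by (rule summable_on_subset[OF wp_summable[OF assms]]) auto
  hence "(\<Sum>\<^sub>\<infinity>\<omega>\<in>insert 0 (period_lattice \<tau> - {0}). 1 / (z - \<omega>)\<^sup>2 - 1 / \<omega>\<^sup>2) = wp \<tau> z"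
    by (subst infsum_insert) (auto simp: wp_def)
  thus ?thesis by (simp add: insert_absorb)
qed

text \<open>
  On the disc of radius \<open>R\<close> only finitely many terms have poles; the remaining ones are dominated by
  \<open>1 / \<bar>\<omega>\<bar>\<^sup>3\<close> uniformly in \<open>z\<close>.
\<close>
lemma wp_split:
  assumes "Im \<tau> > 0" "R > 0" "norm z \<le> R"
  shows "wp \<tau> z = (\<Sum>\<omega>\<in>{\<omega> \<in> period_lattice \<tau>. norm \<omega> < 2 * R}. 1 / (z - \<omega>)\<^sup>2 - 1 / \<omega>\<^sup>2) +
           (\<Sum>\<^sub>\<infinity>\<omega>\<in>{\<omega> \<in> period_lattice \<tau>. 2 * R \<le> norm \<omega>}. 1 / (z - \<omega>)\<^sup>2 - 1 / \<omega>\<^sup>2)"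
proof -
  have "wp \<tau> z = (\<Sum>\<^sub>\<infinity>\<omega>\<in>{\<omega> \<in> period_lattice \<tau>. norm \<omega> < 2 * R} \<union> {\<omega> \<in> period_lattice \<tau>. 2 * R \<le> norm \<omega>}.
           1 / (z - \<omega>)\<^sup>2 - 1 / \<omega>\<^sup>2)"
    by (subst period_lattice_split[symmetric]) (rule wp_eq[OF assms(1)])
  also have "\<dots> = (\<Sum>\<^sub>\<infinity>\<omega>\<in>{\<omega> \<in> period_lattice \<tau>. norm \<omega> < 2 * R}. 1 / (z - \<omega>)\<^sup>2 - 1 / \<omega>\<^sup>2) +
           (\<Sum>\<^sub>\<infinity>\<omega>\<in>{\<omega> \<in> period_lattice \<tau>. 2 * R \<le> norm \<omega>}. 1 / (z - \<omega>)\<^sup>2 - 1 / \<omega>\<^sup>2)"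
    by (intro infsum_Un_disjoint wp_tail_summable assms summable_on_finite period_lattice_finite_ball) auto
  finally show ?thesis
    using period_lattice_finite_ball[OF assms(1)] by simp
qed

lemma wp_tail_holomorphic:
  assumes "Im \<tau> > 0" "R > 0"
  shows "(\<lambda>z. \<Sum>\<^sub>\<infinity>\<omega>\<in>{\<omega> \<in> period_lattice \<tau>. 2 * R \<le> norm \<omega>}. 1 / (z - \<omega>)\<^sup>2 - 1 / \<omega>\<^sup>2)
           holomorphic_on ball 0 R"
proof -
  let ?S = "{\<omega> \<in> period_lattice \<tau>. 2 * R \<le> norm \<omega>}"
  have lim: "uniform_limit (cball 0 R) (\<lambda>X z. \<Sum>\<omega>\<in>X. 1 / (z - \<omega>)\<^sup>2 - 1 / \<omega>\<^sup>2)
          (\<lambda>z. \<Sum>\<^sub>\<infinity>\<omega>\<in>?S. 1 / (z - \<omega>)\<^sup>2 - 1 / \<omega>\<^sup>2) (finite_subsets_at_top ?S)"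
  proof (rule Weierstrass_m_test_general)
    fix \<omega> z :: complex assume "\<omega> \<in> ?S" "z \<in> cball 0 R"
    thus "norm (1 / (z - \<omega>)\<^sup>2 - 1 / \<omega>\<^sup>2) \<le> 10 * R * (1 / norm \<omega> ^ 3)"
      using assms(2) by (intro wp_term_bound) auto
  next
    show "(\<lambda>\<omega>. 10 * R * (1 / norm \<omega> ^ 3)) summable_on ?S"
      by (rule summable_on_cmult_right, rule summable_on_subset[OF summable_on_period_lattice_cube[OF assms(1)]]) auto
  qed
  have holo: "(\<lambda>z. \<Sum>\<omega>\<in>X. 1 / (z - \<omega>)\<^sup>2 - 1 / \<omega>\<^sup>2) holomorphic_on cball 0 R" if "X \<subseteq> ?S" for X
  proof (intro holomorphic_on_sum holomorphic_on_diff)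
    fix \<omega> assume \<omega>: "\<omega> \<in> X"
    have "(z - \<omega>)\<^sup>2 \<noteq> 0" if "z \<in> cball 0 R" for z
      using that \<omega> \<open>X \<subseteq> ?S\<close> assms(2) by auto
    thus "(\<lambda>z. 1 / (z - \<omega>)\<^sup>2) holomorphic_on cball 0 R"
      by (intro holomorphic_intros) auto
  qed auto
  have "eventually (\<lambda>X. X \<subseteq> ?S) (finite_subsets_at_top ?S)"
    by (simp add: eventually_finite_subsets_at_top_weakI)
  hence "eventually (\<lambda>X. continuous_on (cball 0 R) (\<lambda>z. \<Sum>\<omega>\<in>X. 1 / (z - \<omega>)\<^sup>2 - 1 / \<omega>\<^sup>2) \<and>
     (\<lambda>z. \<Sum>\<omega>\<in>X. 1 / (z - \<omega>)\<^sup>2 - 1 / \<omega>\<^sup>2) holomorphic_on ball 0 R) (finite_subsets_at_top ?S)"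
    by eventually_elim
       (use holo in \<open>blast intro: holomorphic_on_imp_continuous_on holomorphic_on_subset[OF _ ball_subset_cball]\<close>)
  from holomorphic_uniform_limit[OF this lim] show ?thesis by auto
qed

lemma wp_holomorphic:
  assumes "Im \<tau> > 0"
  shows "wp \<tau> holomorphic_on (- period_lattice \<tau>)"
proof -
  have "wp \<tau> field_differentiable at z" if z: "z \<notin> period_lattice \<tau>" for z
  proof -
    define R where "R = norm z + 1"
    have R: "R > 0" by (simp add: R_def add_nonneg_pos)
    let ?U = "ball 0 R \<inter> - period_lattice \<tau>"
    have "(\<lambda>z. (\<Sum>\<omega>\<in>{\<omega> \<in> period_lattice \<tau>. norm \<omega> < 2 * R}. 1 / (z - \<omega>)\<^sup>2 - 1 / \<omega>\<^sup>2) +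
           (\<Sum>\<^sub>\<infinity>\<omega>\<in>{\<omega> \<in> period_lattice \<tau>. 2 * R \<le> norm \<omega>}. 1 / (z - \<omega>)\<^sup>2 - 1 / \<omega>\<^sup>2)) holomorphic_on ?U"
    proof (intro holomorphic_on_add holomorphic_on_sum holomorphic_on_diff)
      show "(\<lambda>z. \<Sum>\<^sub>\<infinity>\<omega>\<in>{\<omega> \<in> period_lattice \<tau>. 2 * R \<le> norm \<omega>}. 1 / (z - \<omega>)\<^sup>2 - 1 / \<omega>\<^sup>2) holomorphic_on ?U"
        by (rule holomorphic_on_subset[OF wp_tail_holomorphic[OF assms R]]) auto
    qed (auto intro!: holomorphic_intros)
    hence "wp \<tau> holomorphic_on ?U"
      by (rule holomorphic_transform) (use wp_split[OF assms R] in auto)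
    thus ?thesis
      by (rule holomorphic_on_imp_differentiable_at)
         (use z closed_period_lattice[OF assms] in \<open>auto simp: R_def\<close>)
  qed
  thus ?thesis
    by (auto simp: holomorphic_on_def intro: field_differentiable_at_within)
qed

lemma wp_double_pole:
  assumes "Im \<tau> > 0"
  shows "(\<lambda>z. z\<^sup>2 * wp \<tau> z) \<midarrow>0\<rightarrow> 1"
proof -
  obtain \<epsilon> where \<epsilon>: "\<epsilon> > 0" "\<And>\<omega>. \<omega> \<in> period_lattice \<tau> \<Longrightarrow> norm \<omega> < \<epsilon> \<Longrightarrow> \<omega> = 0"
    using period_lattice_gap[OF assms] by blast
  define R where "R = \<epsilon> / 2"
  have R: "R > 0" using \<epsilon> by (simp add: R_def)
  have eq: "{\<omega> \<in> period_lattice \<tau>. norm \<omega> < 2 * R} = {0}"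
    using \<epsilon> by (auto simp: R_def)
  define h where "h = (\<lambda>z. \<Sum>\<^sub>\<infinity>\<omega>\<in>{\<omega> \<in> period_lattice \<tau>. 2 * R \<le> norm \<omega>}. 1 / (z - \<omega>)\<^sup>2 - 1 / \<omega>\<^sup>2)"
  have "h holomorphic_on ball 0 R"
    unfolding h_def by (rule wp_tail_holomorphic[OF assms R])
  hence "isCont h 0"
    using R by (metis holomorphic_on_imp_continuous_on continuous_on_eq_continuous_at
        open_ball centre_in_ball)
  hence "(\<lambda>z. 1 + z\<^sup>2 * h z) \<midarrow>0\<rightarrow> 1 + 0\<^sup>2 * h 0"
    by (intro tendsto_intros) (simp add: isCont_def)
  moreover have "eventually (\<lambda>z. 1 + z\<^sup>2 * h z = z\<^sup>2 * wp \<tau> z) (at 0)"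
    unfolding eventually_at
  proof (intro exI[of _ R] conjI R ballI impI)
    fix z :: complex assume "z \<noteq> 0 \<and> dist z 0 < R"
    thus "1 + z\<^sup>2 * h z = z\<^sup>2 * wp \<tau> z"
      using wp_split[OF assms R, of z] unfolding eq by (simp add: distrib_left h_def)
  qed
  ultimately show ?thesis
    using Lim_transform_eventually by fastforce
qed

lemma wp_even:
  assumes "Im \<tau> > 0"
  shows "wp \<tau> (- z) = wp \<tau> z"
proof -
  have "bij_betw uminus (period_lattice \<tau>) (period_lattice \<tau>)"
    by (rule bij_betwI[of _ _ _ uminus]) auto
  hence "(\<Sum>\<^sub>\<infinity>\<omega>\<in>period_lattice \<tau>. 1 / (- z - (- \<omega>))\<^sup>2 - 1 / (- \<omega>)\<^sup>2) =
        (\<Sum>\<^sub>\<infinity>\<omega>\<in>period_lattice \<tau>. 1 / (- z - \<omega>)\<^sup>2 - 1 / \<omega>\<^sup>2)"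
    by (rule infsum_reindex_bij_betw)
  thus ?thesis by (simp add: wp_eq[OF assms] power2_commute)
qed

lemma summable_on_inverse_square_progression:
  assumes "a \<noteq> (0 :: complex)"
  shows "(\<lambda>m :: int. 1 / (w - of_int m * a)\<^sup>2) summable_on UNIV"
proof -
  \<comment> \<open>beyond \<open>N\<close> the multiple of \<open>a\<close> has at least twice the norm of \<open>w\<close>\<close>
  define N where "N = \<lceil>2 * norm w / norm a\<rceil> + 1"
  have "(\<lambda>m :: int. (16 / norm a ^ 2) * (1 + real_of_int \<bar>m\<bar>) powr (- 2)) summable_on UNIV"
    by (intro summable_on_cmult_right summable_powr_int) auto
  hence "(\<lambda>m :: int. (16 / norm a ^ 2) * (1 + real_of_int \<bar>m\<bar>) powr (- 2)) summable_on (UNIV - {-N..N})"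
    by (rule summable_on_subset) auto
  hence "(\<lambda>m :: int. norm (1 / (w - of_int m * a)\<^sup>2)) summable_on (UNIV - {-N..N})"
  proof (rule Infinite_Sum.abs_summable_on_comparison_test')
    fix m :: int assume "m \<in> UNIV - {-N..N}"
    hence m: "\<bar>m\<bar> > N" by auto
    have "0 \<le> 2 * norm w / norm a" by simp
    hence m1: "real_of_int \<bar>m\<bar> \<ge> 1" "real_of_int \<bar>m\<bar> \<ge> 2 * norm w / norm a"
      using m unfolding N_def by linarith+
    have "real_of_int \<bar>m\<bar> * norm a \<ge> 2 * norm w"
      using m1(2) assms by (simp add: field_simps)
    moreover have "norm (w - of_int m * a) \<ge> real_of_int \<bar>m\<bar> * norm a - norm w"
      using norm_triangle_ineq2[of "of_int m * a" w] by (simp add: norm_mult norm_minus_commute)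
    ultimately have "norm (w - of_int m * a) \<ge> real_of_int \<bar>m\<bar> * norm a / 2" by linarith
    moreover have "real_of_int \<bar>m\<bar> * norm a / 2 \<ge> (1 + real_of_int \<bar>m\<bar>) / 2 * norm a / 2"
      using m1 by (intro divide_right_mono mult_right_mono) auto
    ultimately have *: "norm (w - of_int m * a) \<ge> (1 + real_of_int \<bar>m\<bar>) / 2 * norm a / 2"
      by linarith
    have "norm (1 / (w - of_int m * a)\<^sup>2) = 1 / norm (w - of_int m * a) ^ 2"
      by (simp add: norm_divide norm_power)
    also have "\<dots> \<le> 1 / ((1 + real_of_int \<bar>m\<bar>) / 2 * norm a / 2) ^ 2"
      using * assms by (intro frac_le power_mono) (auto intro!: mult_pos_pos add_pos_nonneg)
    also have "\<dots> = (16 / norm a ^ 2) * (1 + real_of_int \<bar>m\<bar>) powr (- 2)"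
      using m1 by (simp add: powr_minus powr_numeral field_simps power2_eq_square)
    finally show "norm (1 / (w - of_int m * a)\<^sup>2) \<le> (16 / norm a ^ 2) * (1 + real_of_int \<bar>m\<bar>) powr (- 2)" .
  qed
  hence "(\<lambda>m :: int. 1 / (w - of_int m * a)\<^sup>2) summable_on (UNIV - {-N..N})"
    by (rule abs_summable_summable)
  hence "(\<lambda>m :: int. 1 / (w - of_int m * a)\<^sup>2) summable_on ((UNIV - {-N..N}) \<union> {-N..N})"
    by (rule summable_on_union) auto
  thus ?thesis by (simp add: Un_Diff_cancel2)
qed

lemma summable_on_diff:
  fixes f g :: "'a \<Rightarrow> complex"
  assumes "f summable_on A" "g summable_on A"
  shows "(\<lambda>x. f x - g x) summable_on A"
  using summable_on_add[OF assms(1), of "\<lambda>x. - g x"] assms(2) by (simp add: summable_on_uminus)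

lemma infsum_diff:
  fixes f g :: "'a \<Rightarrow> complex"
  assumes "f summable_on A" "g summable_on A"
  shows "(\<Sum>\<^sub>\<infinity>x\<in>A. f x - g x) = infsum f A - infsum g A"
  using infsum_add[OF assms(1), of "\<lambda>x. - g x"] assms(2) by (simp add: summable_on_uminus infsum_uminus)

text \<open>
  The two parts of the difference need not be summable over the whole plane array, but they are
  summable along each row, where a translation of the index makes their sums equal.
\<close>
lemma infsum_shift_diff_eq_0:
  fixes g :: "int \<times> int \<Rightarrow> complex"
  assumes "(\<lambda>(n, m). g (n, m - 1) - g (n, m)) summable_on UNIV"
    and row: "\<And>n. (\<lambda>m. g (n, m)) summable_on UNIV"
  shows "(\<Sum>\<^sub>\<infinity>(n, m)\<in>UNIV. g (n, m - 1) - g (n, m)) = 0"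
proof -
  have bij: "bij_betw (\<lambda>m :: int. m - 1) UNIV UNIV"
    by (rule bij_betwI[of _ _ _ "\<lambda>m. m + 1"]) auto
  have "(\<Sum>\<^sub>\<infinity>m. g (n, m - 1) - g (n, m)) = 0" for n
  proof -
    have "(\<lambda>m. g (n, m - 1)) summable_on UNIV"
      using row[of n] summable_on_reindex_bij_betw[OF bij, of "\<lambda>m. g (n, m)"] by simp
    hence "(\<Sum>\<^sub>\<infinity>m. g (n, m - 1) - g (n, m)) = (\<Sum>\<^sub>\<infinity>m. g (n, m - 1)) - (\<Sum>\<^sub>\<infinity>m. g (n, m))"
      using row[of n] by (intro infsum_diff) auto
    also have "(\<Sum>\<^sub>\<infinity>m. g (n, m - 1)) = (\<Sum>\<^sub>\<infinity>m. g (n, m))"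
      by (rule infsum_reindex_bij_betw[OF bij])
    finally show ?thesis by simp
  qed
  moreover have "(\<Sum>\<^sub>\<infinity>n. \<Sum>\<^sub>\<infinity>m. g (n, m - 1) - g (n, m)) = (\<Sum>\<^sub>\<infinity>(n, m)\<in>UNIV \<times> UNIV. g (n, m - 1) - g (n, m))"
    using assms(1) by (intro infsum_Sigma'_banach) (simp add: case_prod_unfold)
  ultimately show ?thesis by simp
qed

text \<open>
  The terms \<open>1 / \<omega>\<^sup>2\<close> cancel in \<open>wp \<tau> (z + a) - wp \<tau> z\<close>, and the remaining terms along the lattice
  direction \<open>a\<close> differ by a shift. The lattice basis \<open>a\<close>, \<open>b\<close> is left open, so that each of the two
  generators can play the part of \<open>a\<close>.
\<close>
lemma wp_add_period:
  assumes \<tau>: "Im \<tau> > 0" and a: "a \<noteq> 0"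
    and bij: "bij_betw (\<lambda>(n, m). of_int m * a + of_int n * b) (UNIV :: (int \<times> int) set) (period_lattice \<tau>)"
  shows "wp \<tau> (z + a) = wp \<tau> z"
proof -
  define l where "l = (\<lambda>(n :: int, m :: int). of_int m * a + of_int n * b)"
  have bij': "bij_betw l UNIV (period_lattice \<tau>)"
    using bij by (simp add: l_def)
  define g where "g = (\<lambda>x. 1 / (z - l x)\<^sup>2)"
  define f where "f = (\<lambda>\<omega>. (1 / (z + a - \<omega>)\<^sup>2 - 1 / \<omega>\<^sup>2) - (1 / (z - \<omega>)\<^sup>2 - 1 / \<omega>\<^sup>2))"
  have f: "f summable_on period_lattice \<tau>"
    unfolding f_def by (rule summable_on_diff[OF wp_summable[OF \<tau>] wp_summable[OF \<tau>]])
  have fl: "f (l (n, m)) = g (n, m - 1) - g (n, m)" for n m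
    by (simp add: f_def l_def g_def algebra_simps)
  have "wp \<tau> (z + a) - wp \<tau> z = infsum f (period_lattice \<tau>)"
    unfolding f_def wp_eq[OF \<tau>] by (rule infsum_diff [symmetric, OF wp_summable[OF \<tau>] wp_summable[OF \<tau>]])
  also have "\<dots> = (\<Sum>\<^sub>\<infinity>x. f (l x))"
    by (rule infsum_reindex_bij_betw[OF bij', symmetric])
  also have "\<dots> = (\<Sum>\<^sub>\<infinity>(n, m)\<in>UNIV. g (n, m - 1) - g (n, m))"
    by (intro infsum_cong) (auto simp: fl)
  also have "\<dots> = 0"
  proof (rule infsum_shift_diff_eq_0)
    have "(\<lambda>x. f (l x)) summable_on UNIV"
      using f by (subst summable_on_reindex_bij_betw[OF bij'])
    thus "(\<lambda>(n, m). g (n, m - 1) - g (n, m)) summable_on UNIV"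
      by (rule summable_on_cong[THEN iffD1, rotated]) (auto simp: fl)
    show "(\<lambda>m. g (n, m)) summable_on UNIV" for n
      using summable_on_inverse_square_progression[OF a, of "z - of_int n * b"]
      by (simp add: g_def l_def algebra_simps)
  qed
  finally show ?thesis by simp
qed

lemma wp_periods:
  assumes "Im \<tau> > 0"
  shows "wp \<tau> (z + 2) = wp \<tau> z" "wp \<tau> (z + 2 * \<tau>) = wp \<tau> z"
proof -
  note bij = period_lattice_bij_betw[OF assms]
  show "wp \<tau> (z + 2 * \<tau>) = wp \<tau> z"
    by (rule wp_add_period[OF assms, where b = 2])
       (use assms bij in \<open>auto simp: case_prod_unfold algebra_simps\<close>)
  have "bij_betw ((\<lambda>(m, n). 2 * of_int m + 2 * of_int n * \<tau>) \<circ> prod.swap) (UNIV :: (int \<times> int) set) (period_lattice \<tau>)"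
    by (rule bij_betw_trans[OF bij_swap bij])
  thus "wp \<tau> (z + 2) = wp \<tau> z"
    by (intro wp_add_period[OF assms, where b = "2 * \<tau>"])
       (auto simp: case_prod_unfold algebra_simps o_def)
qed

section \<open>The q-product and Euler's identity\<close>

text \<open>
  In the usual notation this is the infinite \<open>q\<close>-Pochhammer symbol \<open>(- p x; p)\<close> with base \<open>p\<close>. Both the
  theta functions and the factors of the three products are made of it.
\<close>
definition qpoch :: "complex \<Rightarrow> complex \<Rightarrow> complex" where
  "qpoch p x = (\<Prod>k. 1 + p ^ Suc k * x)"

lemma qpoch_has_prod:
  assumes "norm p < 1"
  shows "(\<lambda>k. 1 + p ^ Suc k * x) has_prod qpoch p x"
proof -
  have "summable (\<lambda>k. norm p ^ k * (norm p * norm x))"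
    using assms by (intro summable_mult2 summable_geometric) auto
  hence "abs_convergent_prod (\<lambda>k. 1 + p ^ Suc k * x)"
    by (subst abs_convergent_prod_conv_summable) (simp add: norm_mult norm_power mult_ac)
  hence "convergent_prod (\<lambda>k. 1 + p ^ Suc k * x)"
    by (rule abs_convergent_prod_imp_convergent_prod)
  thus ?thesis
    unfolding qpoch_def by (rule convergent_prod_has_prod)
qed

lemma qpoch_LIMSEQ:
  assumes "norm p < 1"
  shows "(\<lambda>n. \<Prod>k<n. 1 + p ^ Suc k * x) \<longlonglongrightarrow> qpoch p x"
  using has_prod_imp_tendsto'[OF qpoch_has_prod[OF assms]] .

lemma qpoch_functional_eq:
  assumes "norm p < 1"
  shows "qpoch p x = (1 + p * x) * qpoch p (p * x)"
proof (rule LIMSEQ_unique)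
  show "(\<lambda>n. \<Prod>k<Suc n. 1 + p ^ Suc k * x) \<longlonglongrightarrow> qpoch p x"
    using qpoch_LIMSEQ[OF assms] by (rule LIMSEQ_Suc)
  have "(\<lambda>n. (1 + p * x) * (\<Prod>k<n. 1 + p ^ Suc k * (p * x))) \<longlonglongrightarrow> (1 + p * x) * qpoch p (p * x)"
    by (intro tendsto_mult_left qpoch_LIMSEQ assms)
  thus "(\<lambda>n. \<Prod>k<Suc n. 1 + p ^ Suc k * x) \<longlonglongrightarrow> (1 + p * x) * qpoch p (p * x)"
    by (subst prod.lessThan_Suc_shift) (simp add: mult_ac)
qed

lemma qpoch_eq_0_iff:
  assumes "norm p < 1"
  shows "qpoch p x = 0 \<longleftrightarrow> (\<exists>k. 1 + p ^ Suc k * x = 0)"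
  using has_prod_eq_0_iff[OF qpoch_has_prod[OF assms]] by (simp add: image_iff eq_commute[of 0])

lemma qpoch_first_zero [simp]:
  assumes "norm p < 1" "p \<noteq> 0"
  shows "qpoch p (- (1 / p)) = 0"
  by (subst qpoch_functional_eq) (use assms in auto)

lemma qpoch_holomorphic:
  assumes "norm p < 1"
  shows "qpoch p holomorphic_on A"
proof -
  have "qpoch p holomorphic_on ball 0 R" for R
  proof -
    have "uniformly_convergent_on (cball 0 R) (\<lambda>n x. \<Prod>k<n. 1 + p ^ Suc k * x)"
    proof (rule uniformly_convergent_on_prod)
      show "uniformly_convergent_on (cball 0 R) (\<lambda>N x. \<Sum>n<N. norm (p ^ Suc n * x))"
      proof (rule Weierstrass_m_test')
        show "summable (\<lambda>k. norm p ^ k * (norm p * R))"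
          using assms by (intro summable_mult2 summable_geometric) auto
        show "norm (norm (p ^ Suc n * x)) \<le> norm p ^ n * (norm p * R)" if "x \<in> cball 0 R" for n x
        proof -
          have "norm p ^ Suc n * norm x \<le> norm p ^ Suc n * R"
            using that by (intro mult_left_mono) auto
          thus ?thesis by (simp add: norm_mult norm_power mult_ac)
        qed
      qed
    qed (auto intro!: continuous_intros)
    then obtain l where l: "uniform_limit (cball 0 R) (\<lambda>n x. \<Prod>k<n. 1 + p ^ Suc k * x) l sequentially"
      by (auto simp: uniformly_convergent_on_def)
    have lq: "l x = qpoch p x" if "x \<in> cball 0 R" for x
      using tendsto_uniform_limitI[OF l that] qpoch_LIMSEQ[OF assms] by (rule LIMSEQ_unique)
    have "l holomorphic_on ball 0 R"
      by (rule holomorphic_uniform_limit[OF _ l])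
         (auto intro!: always_eventually holomorphic_intros holomorphic_on_imp_continuous_on)
    thus ?thesis
      by (rule holomorphic_transform) (use lq in auto)
  qed
  hence "qpoch p field_differentiable at x" for x
    by (rule holomorphic_on_imp_differentiable_at[of _ "ball 0 (norm x + 1)"]) (auto intro: add_nonneg_pos)
  thus ?thesis
    by (auto simp: holomorphic_on_def intro: field_differentiable_at_within)
qed

lemma qpoch_holomorphic' [holomorphic_intros]:
  assumes "norm p < 1" "f holomorphic_on A"
  shows "(\<lambda>x. qpoch p (f x)) holomorphic_on A"
  using holomorphic_on_compose[OF assms(2) qpoch_holomorphic[OF assms(1)]] by (simp add: o_def)

lemma qpoch_tendsto [tendsto_intros]:
  assumes "norm p < 1" "(f \<longlongrightarrow> x) F"
  shows "((\<lambda>y. qpoch p (f y)) \<longlongrightarrow> qpoch p x) F"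
proof -
  have "isCont (qpoch p) x"
    using holomorphic_on_imp_continuous_on[OF qpoch_holomorphic[OF assms(1), of UNIV]]
    by (simp add: continuous_on_eq_continuous_at)
  thus ?thesis using assms(2) by (rule isCont_tendsto_compose)
qed

lemma qpoch_nonzero:
  assumes "norm p < 1" "norm (p * x) < 1"
  shows "qpoch p x \<noteq> 0"
proof
  assume "qpoch p x = 0"
  then obtain k where "p ^ Suc k * x = - 1"
    by (auto simp: qpoch_eq_0_iff[OF assms(1)] add_eq_0_iff)
  hence "norm (p ^ k * (p * x)) = 1" by (simp add: mult_ac)
  moreover have "norm (p ^ k * (p * x)) \<le> 1 * norm (p * x)"
    unfolding norm_mult[of "p ^ k"] norm_power
    using assms(1) by (intro mult_right_mono power_le_one) auto
  ultimately show False using assms(2) by simp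
qed

text \<open>
  This is Euler's identity between partitions into odd and into distinct parts. The product
  \<open>qpoch p (- 1)\<close> of all \<open>1 - p\<^sup>k\<close> splits into odd and even \<open>k\<close>: the factors with even \<open>k\<close> are those of
  \<open>qpoch p 1 * qpoch p (- 1)\<close>, and those with odd \<open>k\<close> are differences of squares with respect to the
  square root \<open>q\<close> of \<open>p\<close>. Cancelling \<open>qpoch p (- 1)\<close> leaves the claim.
\<close>
lemma euler_odd_distinct:
  assumes "norm p < 1" "q\<^sup>2 = p" "q \<noteq> 0"
  shows "qpoch p (1 / q) * qpoch p (- (1 / q)) * qpoch p 1 = 1"
proof -
  have p2: "norm (p\<^sup>2) < 1"
    using assms(1) by (simp add: norm_power power_less_one_iff)
  have p0: "p \<noteq> 0" using assms by auto
  have odd: "qpoch p (1 / q) * qpoch p (- (1 / q)) = qpoch (p\<^sup>2) (- (1 / p))"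
  proof (rule LIMSEQ_unique)
    show "(\<lambda>n. (\<Prod>k<n. 1 + p ^ Suc k * (1 / q)) * (\<Prod>k<n. 1 + p ^ Suc k * (- (1 / q))))
            \<longlonglongrightarrow> qpoch p (1 / q) * qpoch p (- (1 / q))"
      by (intro tendsto_mult qpoch_LIMSEQ assms)
    have "(1 + p ^ Suc k * (1 / q)) * (1 + p ^ Suc k * (- (1 / q))) = 1 + (p\<^sup>2) ^ Suc k * (- (1 / p))" for k
    proof -
      have "(1 + p ^ Suc k * (1 / q)) * (1 + p ^ Suc k * (- (1 / q))) = 1 - (p ^ Suc k)\<^sup>2 / q\<^sup>2"
        by (simp add: power2_eq_square algebra_simps)
      also have "\<dots> = 1 + (p\<^sup>2) ^ Suc k * (- (1 / p))"
        by (simp add: assms(2) power_mult [symmetric] power_mult_distrib mult.commute)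
      finally show ?thesis .
    qed
    hence "(\<lambda>n. (\<Prod>k<n. 1 + p ^ Suc k * (1 / q)) * (\<Prod>k<n. 1 + p ^ Suc k * (- (1 / q)))) =
           (\<lambda>n. \<Prod>k<n. 1 + (p\<^sup>2) ^ Suc k * (- (1 / p)))"
      by (simp add: prod.distrib [symmetric])
    thus "(\<lambda>n. (\<Prod>k<n. 1 + p ^ Suc k * (1 / q)) * (\<Prod>k<n. 1 + p ^ Suc k * (- (1 / q))))
            \<longlonglongrightarrow> qpoch (p\<^sup>2) (- (1 / p))"
      by (simp only: qpoch_LIMSEQ[OF p2])
  qed
  have even: "qpoch p 1 * qpoch p (- 1) = qpoch (p\<^sup>2) (- 1)"
  proof (rule LIMSEQ_unique)
    show "(\<lambda>n. (\<Prod>k<n. 1 + p ^ Suc k * 1) * (\<Prod>k<n. 1 + p ^ Suc k * (- 1)))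
            \<longlonglongrightarrow> qpoch p 1 * qpoch p (- 1)"
      by (intro tendsto_mult qpoch_LIMSEQ assms)
    have "(1 + p ^ Suc k * 1) * (1 + p ^ Suc k * (- 1)) = 1 + (p\<^sup>2) ^ Suc k * (- 1)" for k
      by (simp add: algebra_simps power2_eq_square power_mult_distrib)
    hence "(\<lambda>n. (\<Prod>k<n. 1 + p ^ Suc k * 1) * (\<Prod>k<n. 1 + p ^ Suc k * (- 1))) =
           (\<lambda>n. \<Prod>k<n. 1 + (p\<^sup>2) ^ Suc k * (- 1))"
      by (simp only: prod.distrib [symmetric])
    thus "(\<lambda>n. (\<Prod>k<n. 1 + p ^ Suc k * 1) * (\<Prod>k<n. 1 + p ^ Suc k * (- 1)))
            \<longlonglongrightarrow> qpoch (p\<^sup>2) (- 1)"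
      by (simp only: qpoch_LIMSEQ[OF p2])
  qed
  have all: "qpoch (p\<^sup>2) (- (1 / p)) * qpoch (p\<^sup>2) (- 1) = qpoch p (- 1)"
  proof (rule LIMSEQ_unique)
    show "(\<lambda>n. (\<Prod>k<n. 1 + (p\<^sup>2) ^ Suc k * (- (1 / p))) * (\<Prod>k<n. 1 + (p\<^sup>2) ^ Suc k * (- 1)))
            \<longlonglongrightarrow> qpoch (p\<^sup>2) (- (1 / p)) * qpoch (p\<^sup>2) (- 1)"
      by (intro tendsto_mult qpoch_LIMSEQ p2)
    have "(\<Prod>k<n. 1 + (p\<^sup>2) ^ Suc k * (- (1 / p))) * (\<Prod>k<n. 1 + (p\<^sup>2) ^ Suc k * (- 1)) =
          (\<Prod>k<2 * n. 1 + p ^ Suc k * (- 1))" for n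
    proof (induction n)
      case (Suc n)
      have "(p\<^sup>2) ^ Suc n * (- (1 / p)) = p ^ Suc (2 * n) * (- 1)" "(p\<^sup>2) ^ Suc n = p ^ Suc (Suc (2 * n))"
        using p0 by (simp_all add: power_mult power2_eq_square)
      moreover have "2 * Suc n = Suc (Suc (2 * n))" by simp
      ultimately show ?case
        using Suc.IH by (simp only: prod.lessThan_Suc mult_ac)
    qed simp
    moreover have "(\<lambda>n. \<Prod>k<2 * n. 1 + p ^ Suc k * (- 1)) \<longlonglongrightarrow> qpoch p (- 1)"
      using LIMSEQ_subseq_LIMSEQ[OF qpoch_LIMSEQ[OF assms(1), of "-1"], of "\<lambda>n. 2 * n"]
      by (simp add: o_def strict_mono_def)
    ultimately show "(\<lambda>n. (\<Prod>k<n. 1 + (p\<^sup>2) ^ Suc k * (- (1 / p))) * (\<Prod>k<n. 1 + (p\<^sup>2) ^ Suc k * (- 1)))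
            \<longlonglongrightarrow> qpoch p (- 1)"
      by (simp only:)
  qed
  have "(qpoch p (1 / q) * qpoch p (- (1 / q)) * qpoch p 1) * qpoch p (- 1) = 1 * qpoch p (- 1)"
    using odd even all by (metis mult.assoc mult_1)
  thus ?thesis
    using qpoch_nonzero[of p "- 1"] assms(1) by simp
qed

section \<open>The Jacobi triple product and the theta constants\<close>

definition qfac :: "complex \<Rightarrow> nat \<Rightarrow> complex" where
  "qfac p n = (\<Prod>k<n. 1 - p ^ Suc k)"

text \<open>
  The reciprocal of \<open>qfac\<close> extended by zero to negative integers, as for the reciprocal Gamma function.
  With this convention the recursion below holds for all integers, and the coefficients of the
  finite triple product need no boundary cases.
\<close>
definition rqfac :: "complex \<Rightarrow> int \<Rightarrow> complex" where
  "rqfac p j = (if j < 0 then 0 else 1 / qfac p (nat j))"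

lemma one_minus_power_nonzero:
  assumes "norm (p :: complex) < 1"
  shows "1 - p ^ Suc k \<noteq> 0"
proof
  assume "1 - p ^ Suc k = 0"
  hence "norm (p ^ Suc k) = 1" by simp
  moreover have "norm (p ^ Suc k) < 1"
    using assms power_Suc_less_one[of "norm p" k] by (cases "p = 0") (auto simp: norm_power norm_mult)
  ultimately show False by simp
qed

lemma qfac_LIMSEQ:
  assumes "norm p < 1"
  shows "qfac p \<longlonglongrightarrow> qpoch p (- 1)"
  using qpoch_LIMSEQ[OF assms, of "-1"] by (simp add: qfac_def[abs_def])

lemma rqfac_rec:
  assumes "norm p < 1" "p \<noteq> 0"
  shows "rqfac p (j - 1) = (1 - p powi j) * rqfac p j"
proof (cases "j > 0")
  case True
  define n where "n = nat (j - 1)"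
  have j: "j = int (Suc n)" using True by (simp add: n_def)
  have nz: "1 - p ^ Suc n \<noteq> 0" by (rule one_minus_power_nonzero[OF assms(1)])
  have "rqfac p (j - 1) = 1 / qfac p n"
    by (simp add: rqfac_def j)
  also have "\<dots> = (1 - p ^ Suc n) * (1 / qfac p (Suc n))"
    using nz by (simp add: qfac_def del: power_Suc)
  also have "\<dots> = (1 - p powi j) * rqfac p j"
    unfolding j rqfac_def power_int_of_nat nat_int by simp
  finally show ?thesis .
qed (auto simp: rqfac_def)

lemma has_sum_int_shift:
  fixes f :: "int \<Rightarrow> 'a :: {topological_comm_monoid_add, t2_space}"
  assumes "(f has_sum S) UNIV"
  shows "((\<lambda>m. f (m + c)) has_sum S) UNIV"
proof -
  have "bij_betw (\<lambda>m :: int. m + c) UNIV UNIV"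
    by (rule bij_betwI[of _ _ _ "\<lambda>m. m - c"]) auto
  from has_sum_reindex_bij_betw[OF this, of f] assms show ?thesis by simp
qed

text \<open>
  The coefficients \<open>T n m\<close> are the Gaussian binomial coefficients of \<open>2 n\<close> over \<open>n + m\<close> to the base \<open>q\<^sup>2\<close>,
  times \<open>q\<close> to the power \<open>m\<^sup>2\<close>, and vanish for \<open>\<bar>m\<bar> > n\<close>. Passing from \<open>n\<close> to \<open>n + 1\<close> multiplies the product by
  \<open>(1 + c x) (1 + c / x) = 1 + c\<^sup>2 + c x + c / x\<close>, where \<open>c\<close> is the power \<open>2 n + 1\<close>
  of \<open>q\<close>. Hence the induction step is the three-term recursion for \<open>T\<close>, which becomes a polynomial identity in \<open>A\<close>, \<open>B\<close> and \<open>1 / p\<close>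
  once all factorials are expressed through the two largest ones.
\<close>
lemma finite_triple_product:
  assumes q: "norm q < 1" "q \<noteq> 0" and x: "x \<noteq> 0"
  defines "T \<equiv> (\<lambda>n m. qfac (q\<^sup>2) (2 * n) * rqfac (q\<^sup>2) (int n + m) * rqfac (q\<^sup>2) (int n - m) * q powi (m\<^sup>2))"
  shows "((\<lambda>m. T n m * x powi m) has_sum
           (\<Prod>k<n. (1 + (q\<^sup>2) ^ Suc k * (x / q)) * (1 + (q\<^sup>2) ^ Suc k * (1 / (q * x))))) UNIV"
proof (induction n)
  case 0
  have "((\<lambda>m. T 0 m * x powi m) has_sum 1) UNIV"
    by (rule has_sum_finite_neutralI[of "{0}"]) (auto simp: T_def rqfac_def qfac_def)
  thus ?case by simp
next
  case (Suc n)
  define p where "p = q\<^sup>2"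
  have p: "norm p < 1" "p \<noteq> 0"
    using q by (auto simp: p_def norm_power power_less_one_iff)
  define c where "c = q ^ (2 * n + 1)"
  have rec: "T (Suc n) m = (1 + c\<^sup>2) * T n m + c * T n (m - 1) + c * T n (m + 1)" for m
  proof -
    define A where "A = p powi (int n + m + 1)"
    define B where "B = p powi (int n - m + 1)"
    define \<alpha> where "\<alpha> = rqfac p (int n + m + 1)"
    define \<beta> where "\<beta> = rqfac p (int n - m + 1)"
    define Q where "Q = q powi (m\<^sup>2)"
    define F where "F = qfac p (2 * n)"
    have a1: "rqfac p (int n + m) = (1 - A) * \<alpha>"
      using rqfac_rec[OF p, of "int n + m + 1"] by (simp add: A_def \<alpha>_def)
    have b1: "rqfac p (int n - m) = (1 - B) * \<beta>"
      using rqfac_rec[OF p, of "int n - m + 1"] by (simp add: B_def \<beta>_def)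
    have a2: "rqfac p (int n + m - 1) = (1 - A / p) * ((1 - A) * \<alpha>)"
      using rqfac_rec[OF p, of "int n + m"] p by (simp add: a1 A_def power_int_add)
    have b2: "rqfac p (int n - m - 1) = (1 - B / p) * ((1 - B) * \<beta>)"
      using rqfac_rec[OF p, of "int n - m"] p by (simp add: b1 B_def power_int_add power_int_diff)
    have pq: "p powi j = q powi (2 * j)" for j
      by (simp add: p_def power_int_mult)
    have AB: "A * B = p ^ (2 * n + 2)"
    proof -
      have "A * B = p powi (int (2 * n + 2))"
        using p(2) unfolding A_def B_def by (subst power_int_add [symmetric]) (auto simp: algebra_simps)
      thus ?thesis by (simp only: power_int_of_nat)
    qed
    have c2: "c\<^sup>2 = A * B / p"
    proof -
      have "c\<^sup>2 * p = p ^ (2 * n + 2)"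
        unfolding c_def p_def power_mult [symmetric] power_add [symmetric] by (simp add: algebra_simps)
      thus ?thesis unfolding AB using p(2) by (simp add: field_simps)
    qed
    have cpow: "c = q powi (2 * int n + 1)"
    proof -
      have "c = q powi int (2 * n + 1)" unfolding c_def by (simp only: power_int_of_nat)
      thus ?thesis by (simp add: add.commute)
    qed
    have cm: "c * q powi ((m - 1)\<^sup>2) = Q * B"
      unfolding cpow Q_def B_def pq using q(2)
      by (simp only: power_int_add [symmetric] simp_thms) (simp add: algebra_simps power2_eq_square)
    have cp: "c * q powi ((m + 1)\<^sup>2) = Q * A"
      unfolding cpow Q_def A_def pq using q(2)
      by (simp only: power_int_add [symmetric] simp_thms) (simp add: algebra_simps power2_eq_square)
    have fac: "qfac p (2 * Suc n) = F * (1 - A * B / p) * (1 - A * B)"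
      unfolding AB F_def qfac_def using p(2) by simp
    have "T (Suc n) m = F * (1 - A * B / p) * (1 - A * B) * \<alpha> * \<beta> * Q"
      unfolding T_def p_def [symmetric] fac by (simp add: \<alpha>_def \<beta>_def Q_def algebra_simps)
    also have "\<dots> = F * \<alpha> * \<beta> * Q * ((1 + A * B / p) * (1 - A) * (1 - B) + B * (1 - A / p) * (1 - A) + A * (1 - B / p) * (1 - B))"
      using p(2) by (simp add: field_simps)
    also have "\<dots> = (1 + c\<^sup>2) * (F * ((1 - A) * \<alpha>) * ((1 - B) * \<beta>) * Q) +
                     F * ((1 - A / p) * ((1 - A) * \<alpha>)) * \<beta> * (Q * B) +
                     F * \<alpha> * ((1 - B / p) * ((1 - B) * \<beta>)) * (Q * A)"
      unfolding c2 by (simp add: algebra_simps add_divide_distrib diff_divide_distrib)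
    also have "\<dots> = (1 + c\<^sup>2) * T n m + c * T n (m - 1) + c * T n (m + 1)"
    proof -
      have args: "int n + (m - 1) = int n + m - 1" "int n - (m - 1) = int n - m + 1"
        "int n + (m + 1) = int n + m + 1" "int n - (m + 1) = int n - m - 1"
        by simp_all
      show ?thesis
        unfolding T_def p_def [symmetric] args a1 b1 a2 b2 F_def [symmetric] \<alpha>_def [symmetric] \<beta>_def [symmetric]
          cm [symmetric] cp [symmetric] Q_def [symmetric]
        by (simp only: mult_ac)
    qed
    finally show ?thesis .
  qed
  define P where "P = (\<Prod>k<n. (1 + p ^ Suc k * (x / q)) * (1 + p ^ Suc k * (1 / (q * x))))"
  have IH: "((\<lambda>m. T n m * x powi m) has_sum P) UNIV"
    using Suc.IH by (simp add: P_def p_def)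
  have "((\<lambda>m. (1 + c\<^sup>2) * (T n m * x powi m) + (c * x) * (T n (m + (-1)) * x powi (m + (-1))) +
           (c / x) * (T n (m + 1) * x powi (m + 1))) has_sum
           (1 + c\<^sup>2) * P + (c * x) * P + (c / x) * P) UNIV"
    by (intro has_sum_add has_sum_cmult_right has_sum_int_shift[of "\<lambda>m. T n m * x powi m"] IH)
  also have "(\<lambda>m. (1 + c\<^sup>2) * (T n m * x powi m) + (c * x) * (T n (m + (-1)) * x powi (m + (-1))) +
           (c / x) * (T n (m + 1) * x powi (m + 1))) = (\<lambda>m. T (Suc n) m * x powi m)"
    using x by (intro ext) (simp add: rec power_int_add power_int_diff field_simps)
  also have "(1 + c\<^sup>2) * P + (c * x) * P + (c / x) * P =
               P * ((1 + p ^ Suc n * (x / q)) * (1 + p ^ Suc n * (1 / (q * x))))"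
  proof -
    have "p ^ Suc n = c * q"
      by (simp add: c_def p_def power_mult [symmetric])
         (simp add: power_add power2_eq_square power_mult)
    thus ?thesis using q x by (simp add: field_simps power2_eq_square)
  qed
  finally show ?case by (simp add: P_def p_def)
qed

lemma qfac_bounds:
  assumes "norm p < 1"
  obtains C where "C > 0" "\<And>n. norm (qfac p n) \<le> C" "\<And>j. norm (rqfac p j) \<le> C"
proof -
  have nz: "qpoch p (- 1) \<noteq> 0" by (rule qpoch_nonzero) (use assms in auto)
  have "Bseq (qfac p)"
    using qfac_LIMSEQ[OF assms] by (intro convergent_imp_Bseq) (auto simp: convergent_def)
  then obtain C1 where C1: "C1 > 0" "\<And>n. norm (qfac p n) \<le> C1"
    by (auto simp: Bseq_def)
  have "(\<lambda>n. 1 / qfac p n) \<longlonglongrightarrow> 1 / qpoch p (- 1)"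
    by (intro tendsto_intros qfac_LIMSEQ assms nz)
  hence "Bseq (\<lambda>n. 1 / qfac p n)"
    by (intro convergent_imp_Bseq) (auto simp: convergent_def)
  then obtain C2 where C2: "C2 > 0" "\<And>n. norm (1 / qfac p n) \<le> C2"
    by (auto simp: Bseq_def)
  show ?thesis
  proof (rule that[of "max C1 C2"])
    show "norm (rqfac p j) \<le> max C1 C2" for j
      using C2(1) C2(2)[of "nat j"] by (auto simp: rqfac_def)
  qed (use C1 in \<open>auto simp: le_max_iff_disj\<close>)
qed

lemma rqfac_LIMSEQ:
  assumes "norm p < 1" "filterlim g at_top sequentially"
  shows "(\<lambda>n. rqfac p (g n)) \<longlonglongrightarrow> 1 / qpoch p (- 1)"
proof -
  have nz: "qpoch p (- 1) \<noteq> 0" by (rule qpoch_nonzero) (use assms in auto)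
  have "filterlim (\<lambda>n. nat (g n)) sequentially sequentially"
    by (rule filterlim_compose[OF filterlim_nat_sequentially assms(2)])
  hence "(\<lambda>n. qfac p (nat (g n))) \<longlonglongrightarrow> qpoch p (- 1)"
    by (rule filterlim_compose[OF qfac_LIMSEQ[OF assms(1)]])
  hence "(\<lambda>n. 1 / qfac p (nat (g n))) \<longlonglongrightarrow> 1 / qpoch p (- 1)"
    by (intro tendsto_intros nz)
  moreover have "eventually (\<lambda>n. g n \<ge> 0) sequentially"
    using assms(2) by (auto simp: filterlim_at_top)
  hence "eventually (\<lambda>n. 1 / qfac p (nat (g n)) = rqfac p (g n)) sequentially"
    by eventually_elim (auto simp: rqfac_def)
  ultimately show ?thesis
    using Lim_transform_eventually by fast
qed

text \<open>
  The limit of the finite identities: the coefficients converge and are dominated by a geometric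
  sequence in \<open>\<bar>m\<bar>\<close> because \<open>x\<close> lies on the unit circle, so limit and sum may be exchanged.
\<close>
lemma jacobi_triple_product:
  assumes q: "norm q < 1" "q \<noteq> 0" and x: "norm x = 1"
  shows "((\<lambda>m. q powi (m\<^sup>2) * x powi m) has_sum
           qpoch (q\<^sup>2) (- 1) * qpoch (q\<^sup>2) (x / q) * qpoch (q\<^sup>2) (1 / (q * x))) UNIV"
proof -
  define p where "p = q\<^sup>2"
  have p: "norm p < 1"
    using q by (auto simp: p_def norm_power power_less_one_iff)
  have x0: "x \<noteq> 0" using x by auto
  define E where "E = qpoch p (- 1)"
  have E: "E \<noteq> 0" unfolding E_def by (rule qpoch_nonzero) (use p in auto)
  define T where "T = (\<lambda>n m. qfac p (2 * n) * rqfac p (int n + m) * rqfac p (int n - m) * q powi (m\<^sup>2))"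
  define L where "L = (\<lambda>m. q powi (m\<^sup>2) / E)"
  obtain C where C: "C > 0" "\<And>n. norm (qfac p n) \<le> C" "\<And>j. norm (rqfac p j) \<le> C"
    using qfac_bounds[OF p] by blast
  have normx: "norm (x powi m) = 1" for m
    using x by (simp add: norm_power_int)
  have qpow: "norm (q powi (m\<^sup>2)) \<le> norm q ^ nat \<bar>m\<bar>" for m
  proof -
    have "norm (q powi (m\<^sup>2)) = norm q powi int (nat (m\<^sup>2))"
      by (simp add: norm_power_int)
    also have "\<dots> = norm q ^ nat (m\<^sup>2)" by (simp only: power_int_of_nat)
    also have "\<dots> \<le> norm q ^ nat \<bar>m\<bar>"
    proof (rule power_decreasing)
      have "\<bar>m\<bar> \<le> \<bar>m\<bar>\<^sup>2" using self_le_power[of "\<bar>m\<bar>" 2] by (cases "m = 0") simp_all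
      thus "nat \<bar>m\<bar> \<le> nat (m\<^sup>2)" by simp
    qed (use q in auto)
    finally show ?thesis .
  qed
  have geo: "(\<lambda>m. norm q ^ nat \<bar>m\<bar>) summable_on (UNIV :: int set)"
    using q by (intro summable_on_int_abs[of "\<lambda>n. norm q ^ n"] summable_geometric) auto
  have T_bound: "norm (T n m * x powi m) \<le> C ^ 3 * norm q ^ nat \<bar>m\<bar>" for n m
  proof -
    have "norm (T n m * x powi m) \<le> C * C * C * norm q ^ nat \<bar>m\<bar>"
      unfolding T_def norm_mult normx mult_1_right using C qpow[of m]
      by (intro mult_mono) (auto intro!: mult_nonneg_nonneg)
    thus ?thesis by (simp add: power3_eq_cube)
  qed
  have T_lim: "(\<lambda>n. T n m * x powi m) \<longlonglongrightarrow> L m * x powi m" for m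
  proof -
    have "filterlim (\<lambda>n. int n + m) at_top sequentially" "filterlim (\<lambda>n. int n - m) at_top sequentially"
      by real_asymp+
    moreover have "(\<lambda>n. qfac p (2 * n)) \<longlonglongrightarrow> E"
      using LIMSEQ_subseq_LIMSEQ[OF qfac_LIMSEQ[OF p], of "\<lambda>n. 2 * n"]
      by (simp add: o_def strict_mono_def E_def)
    ultimately have "(\<lambda>n. T n m * x powi m) \<longlonglongrightarrow> E * (1 / E) * (1 / E) * q powi (m\<^sup>2) * x powi m"
      unfolding T_def E_def by (intro tendsto_mult rqfac_LIMSEQ[OF p] tendsto_const)
    thus ?thesis using E by (simp add: L_def)
  qed
  have "(\<lambda>m. norm (q powi (m\<^sup>2) * x powi m)) summable_on UNIV"
    by (rule Infinite_Sum.abs_summable_on_comparison_test'[OF geo]) (simp add: norm_mult normx qpow)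
  hence summ: "(\<lambda>m. q powi (m\<^sup>2) * x powi m) summable_on UNIV"
    by (rule abs_summable_summable)
  hence L_sum: "((\<lambda>m. L m * x powi m) has_sum (infsum (\<lambda>m. q powi (m\<^sup>2) * x powi m) UNIV / E)) UNIV"
    using has_sum_cmult_right[OF has_sum_infsum[OF summ], of "1 / E"] by (simp add: L_def)
  define P where "P = (\<lambda>n. \<Prod>k<n. (1 + p ^ Suc k * (x / q)) * (1 + p ^ Suc k * (1 / (q * x))))"
  have P_sum: "((\<lambda>m. T n m * x powi m) has_sum P n) UNIV" for n
    using finite_triple_product[OF q x0, of n] by (simp add: T_def P_def p_def)
  have "P \<longlonglongrightarrow> infsum (\<lambda>m. q powi (m\<^sup>2) * x powi m) UNIV / E"
  proof (rule swap_uniform_limit')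
    show "\<forall>\<^sub>F X in finite_subsets_at_top UNIV.
            ((\<lambda>n. \<Sum>m\<in>X. T n m * x powi m) \<longlongrightarrow> (\<Sum>m\<in>X. L m * x powi m)) sequentially"
      by (intro always_eventually allI tendsto_sum T_lim)
    show "((\<lambda>X. \<Sum>m\<in>X. L m * x powi m) \<longlongrightarrow> infsum (\<lambda>m. q powi (m\<^sup>2) * x powi m) UNIV / E)
            (finite_subsets_at_top UNIV)"
      using L_sum by (simp add: has_sum_def)
    show "uniform_limit UNIV (\<lambda>X n. \<Sum>m\<in>X. T n m * x powi m) P (finite_subsets_at_top UNIV)"
      by (rule Weierstrass_m_test_general'[where M = "\<lambda>m. C ^ 3 * norm q ^ nat \<bar>m\<bar>"])
         (use T_bound P_sum geo in \<open>auto intro: summable_on_cmult_right\<close>)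
  qed auto
  moreover have "P \<longlonglongrightarrow> qpoch p (x / q) * qpoch p (1 / (q * x))"
    unfolding P_def prod.distrib by (intro tendsto_mult qpoch_LIMSEQ p)
  ultimately have "infsum (\<lambda>m. q powi (m\<^sup>2) * x powi m) UNIV / E = qpoch p (x / q) * qpoch p (1 / (q * x))"
    by (rule LIMSEQ_unique)
  hence "infsum (\<lambda>m. q powi (m\<^sup>2) * x powi m) UNIV = E * qpoch p (x / q) * qpoch p (1 / (q * x))"
    using E by (simp add: field_simps)
  thus ?thesis
    using has_sum_infsum[OF summ] by (simp add: E_def p_def)
qed

text \<open>
  The triple product at \<open>x = 1\<close> and at \<open>x = - 1\<close> factors the two theta constants, and Euler's identity
  eliminates the half-integral powers of \<open>p\<close>.
\<close>
lemma theta_product: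
  assumes "Im \<tau> > 0"
  defines "p \<equiv> exp (2 * \<i> * of_real pi * \<tau>)"
  shows "theta3_0 \<tau> * theta4_0 \<tau> = (qpoch p (- 1) / qpoch p 1)\<^sup>2"
proof -
  define q where "q = exp (\<i> * of_real pi * \<tau>)"
  have q: "norm q < 1" "q \<noteq> 0" using assms by (auto simp: q_def)
  have p: "p = q\<^sup>2" by (simp add: p_def q_def exp_double [symmetric] mult_ac)
  have pn: "norm p < 1" using q by (simp add: p norm_power power_less_one_iff)
  have qpow: "exp (\<i> * of_real pi * \<tau> * of_int m ^ 2) = q powi (m\<^sup>2)" for m :: int
    by (simp add: q_def exp_power_int mult_ac)
  have t3: "theta3_0 \<tau> = qpoch p (- 1) * qpoch p (1 / q) * qpoch p (1 / q)"
    using infsumI[OF jacobi_triple_product[OF q, of 1]] unfolding theta3_0_def qpow p by simp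
  have t4: "theta4_0 \<tau> = qpoch p (- 1) * qpoch p (- (1 / q)) * qpoch p (- (1 / q))"
    using infsumI[OF jacobi_triple_product[OF q, of "-1"]]
    unfolding theta4_0_def qpow p by (simp add: mult.commute)
  have euler: "qpoch p (1 / q) * qpoch p (- (1 / q)) * qpoch p 1 = 1"
    by (rule euler_odd_distinct[OF pn]) (use p q in auto)
  hence "qpoch p (1 / q) * qpoch p (- (1 / q)) = 1 / qpoch p 1"
    using qpoch_nonzero[of p 1] pn by (simp add: eq_divide_eq)
  have "theta3_0 \<tau> * theta4_0 \<tau> = (qpoch p (- 1) * (qpoch p (1 / q) * qpoch p (- (1 / q))))\<^sup>2"
    by (simp add: t3 t4 power2_eq_square mult_ac)
  also have "\<dots> = (qpoch p (- 1) / qpoch p 1)\<^sup>2"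
    using \<open>qpoch p (1 / q) * qpoch p (- (1 / q)) = 1 / qpoch p 1\<close> by simp
  finally show ?thesis .
qed

section \<open>Quotients of theta products\<close>

text \<open>
  Up to an elementary factor this is a Jacobi theta function of \<open>z\<close>, where \<open>w\<close> is the exponential of
  \<open>\<i> \<pi> z\<close>; the choice of \<open>s\<close> determines which of the four.
\<close>
definition theta_pair :: "complex \<Rightarrow> complex \<Rightarrow> complex \<Rightarrow> complex" where
  "theta_pair p s w = qpoch p (s * w) * qpoch p (s / w)"

lemma theta_pair_inverse: "theta_pair p s (1 / w) = theta_pair p s w"
  by (simp add: theta_pair_def)

text \<open>
  Quasi-periodicity under \<open>w \<mapsto> p w\<close>, which is the translation of \<open>z\<close> by the period \<open>2 \<tau>\<close>. The
  form without division also covers those \<open>w\<close> for which a factor vanishes.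
\<close>
lemma theta_pair_shift:
  assumes "norm p < 1" "p \<noteq> 0" "w \<noteq> 0"
  shows "(1 + s * (p * w)) * theta_pair p s (p * w) = (1 + s / w) * theta_pair p s w"
proof -
  have "qpoch p (s * w) = (1 + s * (p * w)) * qpoch p (s * (p * w))"
    using qpoch_functional_eq[OF assms(1), of "s * w"] by (simp add: mult_ac)
  moreover have "qpoch p (s / (p * w)) = (1 + s / w) * qpoch p (s / w)"
    using qpoch_functional_eq[OF assms(1), of "s / (p * w)"] assms(2) by simp
  ultimately show ?thesis by (simp add: theta_pair_def mult_ac)
qed

text \<open>
  If \<open>s\<close> is a square root of \<open>1 / p\<close>, the factors \<open>1 + s p w\<close> and \<open>1 + s / w\<close> of the general relation
  are proportional. They cannot simply be cancelled, as they may vanish, so the relation is derived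
  again with \<open>p s = 1 / s\<close> inserted.
\<close>
lemma theta_pair_shift_half:
  assumes "norm p < 1" "s\<^sup>2 * p = 1" "w \<noteq> 0"
  shows "theta_pair p s (p * w) = (s / w) * theta_pair p s w"
proof -
  have nz: "p \<noteq> 0" "s \<noteq> 0" using assms(2) by auto
  have ps: "p * s = 1 / s" using assms(2) nz by (simp add: field_simps power2_eq_square)
  have "qpoch p (s * w) = (1 + w / s) * qpoch p (w / s)"
    using qpoch_functional_eq[OF assms(1), of "s * w"] ps by (simp flip: mult.assoc)
  moreover have "qpoch p (s / (p * w)) = (1 + s / w) * qpoch p (s / w)"
    using qpoch_functional_eq[OF assms(1), of "s / (p * w)"] nz by simp
  moreover have "s * (p * w) = w / s" using ps by (metis mult.assoc mult.commute times_divide_eq_right mult_1)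
  ultimately have "theta_pair p s (p * w) = (1 + s / w) * qpoch p (w / s) * qpoch p (s / w)"
    "theta_pair p s w = (1 + w / s) * qpoch p (w / s) * qpoch p (s / w)"
    by (simp_all add: theta_pair_def)
  thus ?thesis using nz assms(3) by (simp add: field_simps)
qed

text \<open>
  The image of the complement of the period lattice under \<open>z \<mapsto> exp (\<i> \<pi> z)\<close>, where \<open>p\<close> is the
  exponential of \<open>2 \<pi> \<i> \<tau>\<close>.
\<close>
definition nome_domain :: "complex \<Rightarrow> complex set" where
  "nome_domain p = {w. w \<noteq> 0 \<and> (\<forall>n :: int. w \<noteq> p powi n)}"

lemma theta_pair_denominator_nonzero:
  assumes "norm p < 1" "p \<noteq> 0" "w \<in> nome_domain p"
  shows "theta_pair p (- 1) w \<noteq> 0"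
proof
  assume "theta_pair p (- 1) w = 0"
  then consider k where "p ^ Suc k * w = 1" | k where "p ^ Suc k / w = 1"
    using assms(1) by (auto simp: theta_pair_def qpoch_eq_0_iff)
  thus False
  proof cases
    case (1 k)
    hence "w = inverse (p ^ Suc k)"
      using assms(2) by (simp add: field_simps)
    hence "w = p powi (- int (Suc k))"
      by (simp only: power_int_minus power_int_of_nat)
    thus False using assms(3) by (auto simp: nome_domain_def)
  next
    case (2 k)
    hence "w = p powi int (Suc k)"
      unfolding power_int_of_nat by (auto simp: field_simps)
    thus False using assms(3) by (auto simp: nome_domain_def)
  qed
qed

lemma nome_domain_not_one: "w \<in> nome_domain p \<Longrightarrow> w \<noteq> 1"
  by (auto simp: nome_domain_def dest: spec[of _ 0])

text \<open>
  The last factor is the normalisation that gives the value \<open>1\<close> at \<open>w = 1\<close>. The three products of the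
  theorem are the values of this function for \<open>s = 1\<close> and for the two square roots \<open>s\<close> of \<open>1 / p\<close>.
\<close>
definition theta_quotient :: "complex \<Rightarrow> complex \<Rightarrow> complex \<Rightarrow> complex" where
  "theta_quotient p s w = (theta_pair p s w / theta_pair p (- 1) w)\<^sup>2 * (qpoch p (- 1) / qpoch p s) ^ 4"

lemma theta_quotient_inverse: "theta_quotient p s (1 / w) = theta_quotient p s w"
  by (simp add: theta_quotient_def theta_pair_inverse)

lemma theta_quotient_holomorphic:
  assumes "norm p < 1" "p \<noteq> 0"
  shows "theta_quotient p s holomorphic_on nome_domain p"
  unfolding theta_quotient_def using assms theta_pair_denominator_nonzero[OF assms]
  unfolding theta_pair_def
  by (intro holomorphic_intros) (auto simp: nome_domain_def)

lemma theta_quotient_tendsto: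
  assumes "norm p < 1" "norm (p * s) < 1"
  shows "(\<lambda>w. theta_quotient p s w) \<midarrow>1\<rightarrow> 1"
proof -
  have nz: "qpoch p (- 1) \<noteq> 0" "qpoch p s \<noteq> 0"
    by (rule qpoch_nonzero; use assms in simp)+
  have "(\<lambda>w. theta_quotient p s w) \<midarrow>1\<rightarrow> (qpoch p (s * 1) * qpoch p (s / 1) / (qpoch p (- 1 * 1) * qpoch p (- 1 / 1)))\<^sup>2 *
          (qpoch p (- 1) / qpoch p s) ^ 4"
    unfolding theta_quotient_def theta_pair_def by (intro tendsto_intros assms) (use nz in auto)
  thus ?thesis using nz by (simp add: field_simps power4_eq_xxxx power2_eq_square)
qed

text \<open>
  The factor \<open>((1 + w) / (1 - w))\<^sup>2\<close> is \<open>- cot\<^sup>2 (\<pi> z / 2)\<close>. It absorbs the factors by which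
  numerator and denominator of the quotient fail to be periodic.
\<close>
lemma cot_square_shift:
  assumes "norm p < 1" "p \<noteq> 0" "w \<in> nome_domain p"
  defines "h \<equiv> (\<lambda>w. ((1 + w) / (1 - w))\<^sup>2 * theta_quotient p 1 w)"
  shows "h (p * w) = h w"
proof -
  have w: "w \<noteq> 0" "1 - w \<noteq> 0" using assms(3) nome_domain_not_one[of w p] by (auto simp: nome_domain_def)
  have 1: "(1 + p * w) * theta_pair p 1 (p * w) = (1 + w) / w * theta_pair p 1 w"
    using theta_pair_shift[OF assms(1,2) w(1), of 1] w by (simp add: field_simps)
  have 2: "(1 - p * w) * theta_pair p (- 1) (p * w) = - ((1 - w) / w * theta_pair p (- 1) w)"
    using theta_pair_shift[OF assms(1,2) w(1), of "- 1"] w by (simp add: field_simps)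
  have h: "h v = (((1 + v) * theta_pair p 1 v) / ((1 - v) * theta_pair p (- 1) v))\<^sup>2 * (qpoch p (- 1) / qpoch p 1) ^ 4" for v
    by (simp add: h_def theta_quotient_def power_mult_distrib power_divide mult_ac)
  show ?thesis
    unfolding h 1 2 using w by (simp add: power_mult_distrib power_divide)
qed

text \<open>
  The factor \<open>w / (1 - w)\<^sup>2\<close> is \<open>- 1 / (4 sin\<^sup>2 (\<pi> z / 2))\<close>; under the shift the combined multiplier is
  \<open>s\<^sup>2 p\<close>.
\<close>
lemma csc_square_shift:
  assumes "norm p < 1" "s\<^sup>2 * p = 1" "w \<in> nome_domain p"
  defines "h \<equiv> (\<lambda>w. w / (1 - w)\<^sup>2 * theta_quotient p s w)"
  shows "h (p * w) = h w"
proof -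
  have p0: "p \<noteq> 0" using assms(2) by auto
  have w: "w \<noteq> 0" "1 - w \<noteq> 0" using assms(3) nome_domain_not_one[of w p] by (auto simp: nome_domain_def)
  have 1: "theta_pair p s (p * w) = s / w * theta_pair p s w"
    by (rule theta_pair_shift_half) fact+
  have 2: "(1 - p * w) * theta_pair p (- 1) (p * w) = - ((1 - w) / w * theta_pair p (- 1) w)"
    using theta_pair_shift[OF assms(1) p0 w(1), of "- 1"] w by (simp add: field_simps)
  have h: "h v = v * (theta_pair p s v / ((1 - v) * theta_pair p (- 1) v))\<^sup>2 * (qpoch p (- 1) / qpoch p s) ^ 4" for v
    by (simp add: h_def theta_quotient_def power_mult_distrib power_divide mult_ac)
  have "h (p * w) = (s\<^sup>2 * p) * h w"
    unfolding h 1 2 using w by (simp add: power_mult_distrib power_divide)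
  thus ?thesis using assms(2) by simp
qed

lemma csc_square_zero:
  assumes "norm p < 1" "s\<^sup>2 * p = 1"
  shows "theta_quotient p s (- (1 / s)) = 0"
proof -
  have nz: "p \<noteq> 0" "s \<noteq> 0" using assms(2) by auto
  have "s / (- (1 / s)) = - (1 / p)"
    using assms(2) nz by (simp add: field_simps power2_eq_square)
  thus ?thesis using assms nz by (simp add: theta_quotient_def theta_pair_def del: div_minus_right)
qed

section \<open>Elliptic functions of the exponential variable\<close>

lemma exp_in_nome_domain:
  assumes "z \<notin> period_lattice \<tau>"
  shows "exp (\<i> * of_real pi * z) \<in> nome_domain (exp (2 * \<i> * of_real pi * \<tau>))"
proof -
  have "exp (\<i> * of_real pi * z) \<noteq> exp (2 * \<i> * of_real pi * \<tau>) powi n" for n :: int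
  proof
    assume "exp (\<i> * of_real pi * z) = exp (2 * \<i> * of_real pi * \<tau>) powi n"
    hence "exp (\<i> * of_real pi * z) = exp (of_int n * (2 * \<i> * of_real pi * \<tau>))"
      by (simp add: exp_power_int)
    then obtain m :: int where "\<i> * of_real pi * z = of_int n * (2 * \<i> * of_real pi * \<tau>) + (of_int (2 * m) * pi) * \<i>"
      by (auto simp: exp_eq)
    hence "(\<i> * of_real pi) * z = (\<i> * of_real pi) * (2 * of_int m + 2 * of_int n * \<tau>)"
      by (simp add: algebra_simps)
    hence "z = 2 * of_int m + 2 * of_int n * \<tau>"
      by (subst (asm) mult_left_cancel) auto
    thus False using assms by (auto simp: period_lattice_def)
  qed
  thus ?thesis by (simp add: nome_domain_def)
qed

text \<open>
  The comparison principle behind all three identities. As a function of \<open>z\<close>, any \<open>h\<close> with the listed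
  properties is even and elliptic with double poles exactly like those of \<open>wp\<close>: near \<open>z = 0\<close>,
  \<open>(1 - w)\<^sup>2\<close> behaves like \<open>- \<pi>\<^sup>2 z\<^sup>2\<close>, which explains the limit that is asked for. The difference
  is constant, and the constant is read off at a zero of \<open>h\<close>.
\<close>
lemma wp_minus_eq:
  assumes \<tau>: "Im \<tau> > 0"
  defines "p \<equiv> exp (2 * \<i> * of_real pi * \<tau>)"
  defines "E \<equiv> (\<lambda>z. exp (\<i> * of_real pi * z))"
  assumes holo: "h holomorphic_on nome_domain p"
    and per: "\<And>w. w \<in> nome_domain p \<Longrightarrow> h (p * w) = h w"
    and inv: "\<And>w. w \<in> nome_domain p \<Longrightarrow> h (1 / w) = h w"
    and lim: "(\<lambda>w. (1 - w)\<^sup>2 * h w) \<midarrow>1\<rightarrow> - (of_real pi)\<^sup>2"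
    and z0: "z0 \<notin> period_lattice \<tau>" "h (E z0) = 0"
    and z: "z \<notin> period_lattice \<tau>"
  shows "wp \<tau> z - wp \<tau> z0 = h (E z)"
proof -
  have dom: "E z \<in> nome_domain p" if "z \<notin> period_lattice \<tau>" for z
    unfolding E_def p_def using that by (rule exp_in_nome_domain)
  have E2: "E (z + 2) = E z" for z
  proof -
    have "E (z + 2) = E z * exp (2 * of_real pi * \<i>)"
      by (simp add: E_def distrib_left exp_add mult_ac)
    thus ?thesis by simp
  qed
  have Etau: "E (z + 2 * \<tau>) = p * E z" for z
    by (simp add: E_def p_def distrib_left exp_add mult_ac)
  have Eneg: "E (- z) = 1 / E z" for z
    by (simp add: E_def exp_minus inverse_eq_divide)
  have "(\<lambda>z. wp \<tau> z - h (E z)) z = (\<lambda>z. wp \<tau> z - h (E z)) z0"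
  proof (rule even_elliptic_constant[OF \<tau> _ _ _ _ _ z z0(1)])
    have "(h \<circ> E) holomorphic_on (- period_lattice \<tau>)"
      by (rule holomorphic_on_compose_gen[OF _ holo])
         (use dom in \<open>auto simp: E_def intro!: holomorphic_intros\<close>)
    thus "(\<lambda>z. wp \<tau> z - h (E z)) holomorphic_on (- period_lattice \<tau>)"
      by (intro holomorphic_on_diff wp_holomorphic \<tau>) (simp add: o_def)
  next
    fix z assume "z \<notin> period_lattice \<tau>"
    from dom[OF this] show "wp \<tau> (z + 2) - h (E (z + 2)) = wp \<tau> z - h (E z)"
      "wp \<tau> (z + 2 * \<tau>) - h (E (z + 2 * \<tau>)) = wp \<tau> z - h (E z)"
      "wp \<tau> (- z) - h (E (- z)) = wp \<tau> z - h (E z)"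
      by (simp_all add: wp_periods[OF \<tau>] wp_even[OF \<tau>] E2 Etau Eneg per inv)
  next
    have "(E has_field_derivative (\<i> * of_real pi)) (at 0)"
      unfolding E_def by (auto intro!: derivative_eq_intros)
    hence "(\<lambda>z. (E z - 1) / z) \<midarrow>0\<rightarrow> \<i> * of_real pi"
      by (simp add: has_field_derivative_iff E_def)
    hence "(\<lambda>z. 1 / ((E z - 1) / z)) \<midarrow>0\<rightarrow> 1 / (\<i> * of_real pi)"
      by (intro tendsto_intros) auto
    hence quot: "(\<lambda>z. (z / (E z - 1))\<^sup>2) \<midarrow>0\<rightarrow> (1 / (\<i> * of_real pi))\<^sup>2"
      by (intro tendsto_power) simp
    obtain \<epsilon> where \<epsilon>: "\<epsilon> > 0" "\<And>\<omega>. \<omega> \<in> period_lattice \<tau> \<Longrightarrow> norm \<omega> < \<epsilon> \<Longrightarrow> \<omega> = 0"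
      using period_lattice_gap[OF \<tau>] by blast
    have "eventually (\<lambda>z. z \<notin> period_lattice \<tau>) (at 0)"
      unfolding eventually_at using \<epsilon> by (intro exI[of _ \<epsilon>]) auto
    hence ne: "eventually (\<lambda>z. E z \<noteq> 1) (at 0)"
      by eventually_elim (use dom nome_domain_not_one in blast)
    have "E \<midarrow>0\<rightarrow> E 0"
      unfolding E_def by (intro tendsto_intros)
    hence "filterlim E (at 1) (at 0)"
      using ne by (intro filterlim_atI) (simp_all add: E_def)
    hence "(\<lambda>z. (1 - E z)\<^sup>2 * h (E z)) \<midarrow>0\<rightarrow> - (of_real pi)\<^sup>2"
      by (rule filterlim_compose[OF lim])
    from tendsto_mult[OF quot this]
    have "(\<lambda>z. (z / (E z - 1))\<^sup>2 * ((1 - E z)\<^sup>2 * h (E z))) \<midarrow>0\<rightarrow> 1"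
      by (simp add: power_divide power_mult_distrib)
    moreover have "eventually (\<lambda>z. (z / (E z - 1))\<^sup>2 * ((1 - E z)\<^sup>2 * h (E z)) = z\<^sup>2 * h (E z)) (at 0)"
      using ne by eventually_elim (simp add: power_divide power2_commute[of 1])
    ultimately have "(\<lambda>z. z\<^sup>2 * h (E z)) \<midarrow>0\<rightarrow> 1"
      using Lim_transform_eventually by fast
    from tendsto_diff[OF wp_double_pole[OF \<tau>] this]
    show "(\<lambda>z. z\<^sup>2 * (wp \<tau> z - h (E z))) \<midarrow>0\<rightarrow> 0"
      by (simp add: right_diff_distrib)
  qed
  thus ?thesis using z0(2) by (simp add: algebra_simps)
qed

section \<open>The trigonometric factors in the exponential variable\<close>

lemma sin_exp_half: "sin u = \<i> / 2 * exp (- (\<i> * u)) * (1 - exp (2 * \<i> * u))" for u :: complex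
proof -
  have "exp (- (\<i> * u)) * exp (2 * \<i> * u) = exp (\<i> * u)"
    by (simp flip: exp_add)
  thus ?thesis by (simp add: sin_exp_eq field_simps)
qed

lemma cos_exp_half: "cos u = 1 / 2 * exp (- (\<i> * u)) * (1 + exp (2 * \<i> * u))" for u :: complex
proof -
  have "exp (- (\<i> * u)) * exp (2 * \<i> * u) = exp (\<i> * u)"
    by (simp flip: exp_add)
  thus ?thesis by (simp add: cos_exp_eq field_simps)
qed

text \<open>
  This holds at the poles as well, where both sides are \<open>0\<close>.
\<close>
lemma cot_exp_half: "cot u = - \<i> * ((1 + exp (2 * \<i> * u)) / (1 - exp (2 * \<i> * u)))" for u :: complex
proof -
  have cancel: "1 / 2 * e * x / (\<i> / 2 * e * y) = - \<i> * (x / y)" if "e \<noteq> 0" for e x y :: complex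
    using that by (cases "y = 0") (simp_all add: field_simps)
  show ?thesis unfolding cot_def sin_exp_half cos_exp_half by (rule cancel) simp
qed

lemma sin_sin_ratio:
  "sin x / sin y = exp (\<i> * (y - x)) * ((1 - exp (2 * \<i> * x)) / (1 - exp (2 * \<i> * y)))" for x y :: complex
proof -
  have "exp (\<i> * (y - x)) = exp (- (\<i> * x)) / exp (- (\<i> * y))"
    by (simp flip: exp_diff add: algebra_simps)
  moreover have "\<i> / 2 * a * c / (\<i> / 2 * b * d) = a / b * (c / d)" for a b c d :: complex
    by simp
  ultimately show ?thesis unfolding sin_exp_half[of x] sin_exp_half[of y] by (simp only:)
qed

lemma cos_sin_ratio:
  "cos x / sin y = - \<i> * exp (\<i> * (y - x)) * ((1 + exp (2 * \<i> * x)) / (1 - exp (2 * \<i> * y)))" for x y :: complex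
proof -
  have "exp (\<i> * (y - x)) = exp (- (\<i> * x)) / exp (- (\<i> * y))"
    by (simp flip: exp_diff add: algebra_simps)
  moreover have "1 / 2 * a * c / (\<i> / 2 * b * d) = - \<i> * (a / b) * (c / d)" if "b \<noteq> 0" for a b c d :: complex
    using that by (cases "d = 0") (simp_all add: field_simps)
  ultimately show ?thesis unfolding cos_exp_half[of x] sin_exp_half[of y] by simp
qed

text \<open>
  The \<open>k\<close>-th factor of \<open>theta_quotient p s w\<close> when the defining products are multiplied out.
\<close>
definition theta_quotient_factor :: "complex \<Rightarrow> complex \<Rightarrow> complex \<Rightarrow> nat \<Rightarrow> complex" where
  "theta_quotient_factor p s w k = ((1 + p ^ k * (s * w)) * (1 + p ^ k * (s / w)) /
     ((1 + p ^ k * (- 1 * w)) * (1 + p ^ k * (- 1 / w))))\<^sup>2 * ((1 + p ^ k * (- 1)) / (1 + p ^ k * s)) ^ 4"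

lemma theta_pair_quotient_has_prod:
  assumes "norm p < 1"
  shows "(\<lambda>k. ((1 + p ^ Suc k * (s * w)) * (1 + p ^ Suc k * (s / w)) /
     ((1 + p ^ Suc k * (- 1 * w)) * (1 + p ^ Suc k * (- 1 / w))))\<^sup>2) has_prod (theta_pair p s w / theta_pair p (- 1) w)\<^sup>2"
  unfolding theta_pair_def by (intro has_prod_power has_prod_divide has_prod_mult qpoch_has_prod assms)

lemma theta_quotient_has_prod:
  assumes "norm p < 1"
  shows "(\<lambda>k. theta_quotient_factor p s w (Suc k)) has_prod theta_quotient p s w"
  unfolding theta_quotient_def theta_quotient_factor_def
  by (intro has_prod_mult theta_pair_quotient_has_prod has_prod_power has_prod_divide qpoch_has_prod assms)

context
  fixes \<tau> z p q w :: complex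
  defines "p \<equiv> exp (2 * \<i> * of_real pi * \<tau>)"
  defines "q \<equiv> exp (\<i> * of_real pi * \<tau>)"
  defines "w \<equiv> exp (\<i> * of_real pi * z)"
begin

lemma exp_ktau: "exp (2 * \<i> * (of_nat k * of_real pi * \<tau>)) = p ^ k"
  unfolding p_def exp_of_nat_mult [symmetric] by (simp add: mult_ac)

lemma exp_ktau_minus: "exp (2 * \<i> * (of_nat k * of_real pi * \<tau> - of_real pi * z / 2)) = p ^ k / w"
  unfolding right_diff_distrib exp_diff exp_ktau by (simp add: w_def mult_ac)

lemma exp_ktau_plus: "exp (2 * \<i> * (of_nat k * of_real pi * \<tau> + of_real pi * z / 2)) = p ^ k * w"
  unfolding distrib_left exp_add exp_ktau by (simp add: w_def mult_ac)

lemma exp_half_ktau: "exp (2 * \<i> * ((of_nat k - 1/2) * of_real pi * \<tau>)) = p ^ k / q"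
proof -
  have "2 * \<i> * ((of_nat k - 1/2) * of_real pi * \<tau>) = 2 * \<i> * (of_nat k * of_real pi * \<tau>) - \<i> * of_real pi * \<tau>"
    by (simp add: algebra_simps)
  thus ?thesis by (simp add: exp_diff exp_ktau q_def)
qed

lemma exp_half_ktau_minus:
  "exp (2 * \<i> * ((of_nat k - 1/2) * of_real pi * \<tau> - of_real pi * z / 2)) = p ^ k / q / w"
  unfolding right_diff_distrib[of _ _ "of_real pi * z / 2"] exp_diff exp_half_ktau by (simp add: w_def mult_ac)

lemma exp_half_ktau_plus:
  "exp (2 * \<i> * ((of_nat k - 1/2) * of_real pi * \<tau> + of_real pi * z / 2)) = p ^ k / q * w"
  unfolding distrib_left[of _ _ "of_real pi * z / 2"] exp_add exp_half_ktau by (simp add: w_def mult_ac)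

lemma factor_e1_theta_eq:
  "factor_e1_theta \<tau> z k = ((1 + p ^ k * (1 * w)) * (1 + p ^ k * (1 / w)) /
     ((1 + p ^ k * (- 1 * w)) * (1 + p ^ k * (- 1 / w))))\<^sup>2"
  unfolding factor_e1_theta_def cot_exp_half exp_ktau_minus exp_ktau_plus
  by (simp add: power_mult_distrib power_divide mult_ac)

lemma factor_e1_eq: "factor_e1 \<tau> z k = theta_quotient_factor p 1 w k"
  unfolding factor_e1_def theta_quotient_factor_def cot_exp_half exp_ktau_minus exp_ktau_plus exp_ktau
  by (simp add: power_mult_distrib power_divide mult_ac)

text \<open>
  Passing from sines to \<open>1 - exp (2 \<i> u)\<close> produces the constant \<open>d\<^sup>2\<close> inside the square and \<open>1 / d\<close>
  inside the fourth power of the normalising factor, so that all constants cancel. The cosines of the next lemma behave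
  in the same way, with another constant.
\<close>
lemma factor_e3_eq: "factor_e3 \<tau> z k = theta_quotient_factor p (- (1 / q)) w k"
proof -
  have "of_nat k * of_real pi * \<tau> - of_real pi * z / 2 - ((of_nat k - 1/2) * of_real pi * \<tau> - of_real pi * z / 2) = of_real pi * \<tau> / 2"
       "of_nat k * of_real pi * \<tau> + of_real pi * z / 2 - ((of_nat k - 1/2) * of_real pi * \<tau> + of_real pi * z / 2) = of_real pi * \<tau> / 2"
       "(of_nat k - 1/2) * of_real pi * \<tau> - of_nat k * of_real pi * \<tau> = - (of_real pi * \<tau> / 2)"
    by (simp_all add: algebra_simps)
  note diffs = this
  define d where "d = exp (\<i> * (of_real pi * \<tau> / 2))"
  have d: "d \<noteq> 0" "exp (\<i> * (- (of_real pi * \<tau> / 2))) = 1 / d"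
    by (simp_all add: d_def exp_minus inverse_eq_divide)
  show ?thesis
    unfolding factor_e3_def theta_quotient_factor_def sin_sin_ratio diffs exp_ktau_minus exp_ktau_plus exp_ktau
      exp_half_ktau exp_half_ktau_minus exp_half_ktau_plus d(2) d_def [symmetric]
    using d(1) by (simp add: power_mult_distrib power_divide mult_ac)
qed

lemma factor_e2_eq: "factor_e2 \<tau> z k = theta_quotient_factor p (1 / q) w k"
proof -
  have "of_nat k * of_real pi * \<tau> - of_real pi * z / 2 - ((of_nat k - 1/2) * of_real pi * \<tau> - of_real pi * z / 2) = of_real pi * \<tau> / 2"
       "of_nat k * of_real pi * \<tau> + of_real pi * z / 2 - ((of_nat k - 1/2) * of_real pi * \<tau> + of_real pi * z / 2) = of_real pi * \<tau> / 2"
       "of_nat k * of_real pi * \<tau> - (of_nat k - 1/2) * of_real pi * \<tau> = of_real pi * \<tau> / 2"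
    by (simp_all add: algebra_simps)
  note diffs = this
  define d where "d = - \<i> * exp (\<i> * (of_real pi * \<tau> / 2))"
  have d: "d \<noteq> 0" by (simp add: d_def)
  have sc: "sin x / cos y = inverse (cos y / sin x)" for x y :: complex by simp
  show ?thesis
    unfolding factor_e2_def theta_quotient_factor_def sc cos_sin_ratio diffs exp_ktau_minus exp_ktau_plus exp_ktau
      exp_half_ktau exp_half_ktau_minus exp_half_ktau_plus d_def [symmetric]
    using d by (simp add: power_mult_distrib power_divide inverse_eq_divide mult_ac)
qed

lemma cot_prefactor: "(of_real pi * cot (of_real pi * z / 2))\<^sup>2 / 4 = - (of_real pi)\<^sup>2 / 4 * ((1 + w) / (1 - w))\<^sup>2"
  unfolding cot_exp_half by (simp add: power_mult_distrib power_divide w_def mult_ac)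

lemma csc_prefactor: "(of_real pi)\<^sup>2 / (2 * sin (of_real pi * z / 2))\<^sup>2 = - (of_real pi)\<^sup>2 * (w / (1 - w)\<^sup>2)"
proof -
  have "exp (- (\<i> * (of_real pi * z / 2))) ^ 2 = 1 / w"
    by (simp add: w_def exp_minus inverse_eq_divide power_divide flip: exp_double) (simp add: mult_ac)
  thus ?thesis
    unfolding sin_exp_half by (simp add: power_mult_distrib power_divide mult_ac) (simp add: w_def mult_ac)
qed

lemma norm_nome:
  assumes \<tau>: "Im \<tau> > 0"
  shows "norm q < 1" "q \<noteq> 0" "q\<^sup>2 = p" "norm p < 1" "p \<noteq> 0"
proof -
  show q: "norm q < 1" "q \<noteq> 0" using \<tau> by (auto simp: q_def)
  show p: "q\<^sup>2 = p" by (simp add: p_def q_def exp_double [symmetric] mult_ac)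
  show "norm p < 1" "p \<noteq> 0" using q by (auto simp: p [symmetric] norm_power power_less_one_iff)
qed

end

section \<open>The three differences\<close>

text \<open>
  The zero used to determine the constant is \<open>w = - 1\<close>, the image of \<open>z = 1\<close>, where the cotangent
  vanishes.
\<close>
lemma wp_minus_e1:
  assumes \<tau>: "Im \<tau> > 0" and z: "z \<notin> period_lattice \<tau>"
  defines "p \<equiv> exp (2 * \<i> * of_real pi * \<tau>)" and "w \<equiv> exp (\<i> * of_real pi * z)"
  shows "wp \<tau> z - wp_e1 \<tau> = - (of_real pi)\<^sup>2 / 4 * ((1 + w) / (1 - w))\<^sup>2 * theta_quotient p 1 w"
  unfolding wp_e1_def w_def
proof (rule wp_minus_eq[OF \<tau>])
  note p = norm_nome(4,5)[OF \<tau>, folded p_def]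
  let ?h = "\<lambda>w. - (of_real pi)\<^sup>2 / 4 * ((1 + w) / (1 - w))\<^sup>2 * theta_quotient p 1 w"
  show "?h holomorphic_on nome_domain (exp (2 * \<i> * of_real pi * \<tau>))"
    unfolding p_def [symmetric]
    by (intro holomorphic_intros theta_quotient_holomorphic p) (use nome_domain_not_one in auto)
  fix v assume v: "v \<in> nome_domain (exp (2 * \<i> * of_real pi * \<tau>))"
  show "?h (exp (2 * \<i> * of_real pi * \<tau>) * v) = ?h v"
    using cot_square_shift[OF p v[folded p_def]] by (simp add: p_def mult.assoc)
  have "v \<noteq> 0" "v \<noteq> 1" using v nome_domain_not_one[of v] by (auto simp: nome_domain_def)
  hence "(1 + 1 / v) / (1 - 1 / v) = - ((1 + v) / (1 - v))"
    by (simp add: field_simps)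
  thus "?h (1 / v) = ?h v" by (simp add: theta_quotient_inverse)
next
  note p = norm_nome(4,5)[OF \<tau>, folded p_def]
  have "(\<lambda>v. - (of_real pi)\<^sup>2 / 4 * (1 + v)\<^sup>2 * theta_quotient p 1 v) \<midarrow>1\<rightarrow> - (of_real pi)\<^sup>2 / 4 * (1 + 1)\<^sup>2 * 1"
    by (intro tendsto_intros theta_quotient_tendsto p) (use p in auto)
  hence "(\<lambda>v. - (of_real pi)\<^sup>2 / 4 * (1 + v)\<^sup>2 * theta_quotient p 1 v) \<midarrow>1\<rightarrow> - (of_real pi)\<^sup>2"
    by simp
  moreover have "eventually (\<lambda>v. - (of_real pi)\<^sup>2 / 4 * (1 + v)\<^sup>2 * theta_quotient p 1 v =
      (1 - v)\<^sup>2 * (- (of_real pi)\<^sup>2 / 4 * ((1 + v) / (1 - v))\<^sup>2 * theta_quotient p 1 v)) (at 1)"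
    unfolding eventually_at by (intro exI[of _ 1]) (simp add: power_divide)
  ultimately show "(\<lambda>v. (1 - v)\<^sup>2 * (- (of_real pi)\<^sup>2 / 4 * ((1 + v) / (1 - v))\<^sup>2 * theta_quotient p 1 v)) \<midarrow>1\<rightarrow> - (of_real pi)\<^sup>2"
    by (rule Lim_transform_eventually)
next
  have "exp (\<i> * of_real pi) = (- 1 :: complex)"
    by (simp add: exp_eq_polar)
  thus "- (of_real pi)\<^sup>2 / 4 * ((1 + exp (\<i> * of_real pi * 1)) / (1 - exp (\<i> * of_real pi * 1)))\<^sup>2 *
          theta_quotient p 1 (exp (\<i> * of_real pi * 1)) = 0" by simp
next
  show "1 \<notin> period_lattice \<tau>"
  proof
    assume "1 \<in> period_lattice \<tau>"
    then obtain m n :: int where mn: "1 = 2 * of_int m + 2 * of_int n * \<tau>"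
      by (auto simp: period_lattice_def)
    hence "n = 0" using \<tau> by (auto dest: arg_cong[of _ _ Im])
    hence "of_int 1 = (of_int (2 * m) :: complex)" using mn by simp
    hence "1 = 2 * m" by (simp only: of_int_eq_iff)
    thus False by presburger
  qed
qed fact

text \<open>
  For \<open>s = - 1 / q\<close> and \<open>s = 1 / q\<close>, where \<open>q\<close> is the exponential of \<open>\<i> \<pi> \<tau>\<close>, the point \<open>z0\<close> is
  \<open>\<tau>\<close> and \<open>1 + \<tau>\<close> respectively, so one statement serves for \<open>e\<^sub>3\<close> and \<open>e\<^sub>2\<close>.
\<close>
lemma wp_minus_csc_form:
  assumes \<tau>: "Im \<tau> > 0" and z: "z \<notin> period_lattice \<tau>" and z0: "z0 \<notin> period_lattice \<tau>"
  defines "p \<equiv> exp (2 * \<i> * of_real pi * \<tau>)" and "w \<equiv> exp (\<i> * of_real pi * z)"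
  assumes s: "s\<^sup>2 * p = 1" "exp (\<i> * of_real pi * z0) = - (1 / s)"
  shows "wp \<tau> z - wp \<tau> z0 = - (of_real pi)\<^sup>2 * (w / (1 - w)\<^sup>2) * theta_quotient p s w"
  unfolding w_def
proof (rule wp_minus_eq[OF \<tau>])
  note p = norm_nome(4,5)[OF \<tau>, folded p_def]
  let ?h = "\<lambda>w. - (of_real pi)\<^sup>2 * (w / (1 - w)\<^sup>2) * theta_quotient p s w"
  show "?h holomorphic_on nome_domain (exp (2 * \<i> * of_real pi * \<tau>))"
    unfolding p_def [symmetric]
    by (intro holomorphic_intros theta_quotient_holomorphic p) (use nome_domain_not_one in auto)
  fix v assume v: "v \<in> nome_domain (exp (2 * \<i> * of_real pi * \<tau>))"
  show "?h (exp (2 * \<i> * of_real pi * \<tau>) * v) = ?h v"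
    using csc_square_shift[OF p(1) s(1) v[folded p_def]] by (simp only: p_def mult.assoc)
  have "v \<noteq> 0" "v \<noteq> 1" using v nome_domain_not_one[of v] by (auto simp: nome_domain_def)
  hence "(1 / v) / (1 - 1 / v)\<^sup>2 = v / (1 - v)\<^sup>2"
    by (simp add: divide_simps power2_eq_square) (simp add: algebra_simps)
  thus "?h (1 / v) = ?h v" by (simp only: theta_quotient_inverse)
next
  note p = norm_nome(4,5)[OF \<tau>, folded p_def]
  have ps: "norm (p * s) < 1"
  proof (rule power_less_imp_less_base)
    have "(p * s)\<^sup>2 = p * (s\<^sup>2 * p)" by (simp add: power2_eq_square)
    hence "norm (p * s) ^ 2 = norm p" using s(1) by (simp flip: norm_power)
    thus "norm (p * s) ^ 2 < 1 ^ 2" using p by simp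
  qed auto
  have "(\<lambda>v. - (of_real pi)\<^sup>2 * v * theta_quotient p s v) \<midarrow>1\<rightarrow> - (of_real pi)\<^sup>2 * 1 * 1"
    by (intro tendsto_intros theta_quotient_tendsto p ps)
  hence "(\<lambda>v. - (of_real pi)\<^sup>2 * v * theta_quotient p s v) \<midarrow>1\<rightarrow> - (of_real pi)\<^sup>2"
    by simp
  moreover have "eventually (\<lambda>v. - (of_real pi)\<^sup>2 * v * theta_quotient p s v =
      (1 - v)\<^sup>2 * (- (of_real pi)\<^sup>2 * (v / (1 - v)\<^sup>2) * theta_quotient p s v)) (at 1)"
    unfolding eventually_at by (intro exI[of _ 1]) simp
  ultimately show "(\<lambda>v. (1 - v)\<^sup>2 * (- (of_real pi)\<^sup>2 * (v / (1 - v)\<^sup>2) * theta_quotient p s v)) \<midarrow>1\<rightarrow> - (of_real pi)\<^sup>2"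
    by (rule Lim_transform_eventually)
next
  note p = norm_nome(4,5)[OF \<tau>, folded p_def]
  show "- (of_real pi)\<^sup>2 * (exp (\<i> * of_real pi * z0) / (1 - exp (\<i> * of_real pi * z0))\<^sup>2) *
          theta_quotient p s (exp (\<i> * of_real pi * z0)) = 0"
    unfolding s(2) csc_square_zero[OF p(1) s(1)] by simp
qed fact+

lemma half_periods_not_in_lattice:
  assumes "Im \<tau> > 0"
  shows "\<tau> \<notin> period_lattice \<tau>" "1 + \<tau> \<notin> period_lattice \<tau>"
proof -
  have *: "a + \<tau> \<notin> period_lattice \<tau>" if "Im a = 0" for a
  proof
    assume "a + \<tau> \<in> period_lattice \<tau>"
    then obtain m n :: int where mn: "a + \<tau> = 2 * of_int m + 2 * of_int n * \<tau>"
      by (auto simp: period_lattice_def)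
    hence "Im \<tau> = 2 * of_int n * Im \<tau>" using that by (auto dest: arg_cong[of _ _ Im])
    hence "of_int 1 = (of_int (2 * n) :: real)" using assms by simp
    hence "1 = 2 * n" by (simp only: of_int_eq_iff)
    thus False by presburger
  qed
  show "\<tau> \<notin> period_lattice \<tau>" "1 + \<tau> \<notin> period_lattice \<tau>" using *[of 0] *[of 1] by simp_all
qed

theorem mainTheorem1:
  fixes \<tau> z :: complex
  assumes "Im \<tau> > 0"
    and "Im z < 2 * Im \<tau>"
    and "z \<notin> period_lattice \<tau>"
  shows "convergent_prod (\<lambda>k. factor_e1 \<tau> z (Suc k)) \<and>
         wp \<tau> z - wp_e1 \<tau> =
           (of_real pi * cot (of_real pi * z / 2))\<^sup>2 / 4 * (\<Prod>k. factor_e1 \<tau> z (Suc k)) \<and>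
         convergent_prod (\<lambda>k. factor_e1_theta \<tau> z (Suc k)) \<and>
         wp \<tau> z - wp_e1 \<tau> =
           (of_real pi * theta3_0 \<tau> * theta4_0 \<tau> * cot (of_real pi * z / 2))\<^sup>2 / 4 *
           (\<Prod>k. factor_e1_theta \<tau> z (Suc k)) \<and>
         convergent_prod (\<lambda>k. factor_e3 \<tau> z (Suc k)) \<and>
         wp \<tau> z - wp_e3 \<tau> =
           (of_real pi)\<^sup>2 / (2 * sin (of_real pi * z / 2))\<^sup>2 * (\<Prod>k. factor_e3 \<tau> z (Suc k)) \<and>
         convergent_prod (\<lambda>k. factor_e2 \<tau> z (Suc k)) \<and>
         wp \<tau> z - wp_e2 \<tau> =
           (of_real pi)\<^sup>2 / (2 * sin (of_real pi * z / 2))\<^sup>2 * (\<Prod>k. factor_e2 \<tau> z (Suc k))"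
proof -
  note \<tau> = assms(1) and z = assms(3)
  define p where "p = exp (2 * \<i> * of_real pi * \<tau>)"
  define q where "q = exp (\<i> * of_real pi * \<tau>)"
  define w where "w = exp (\<i> * of_real pi * z)"
  have q: "q \<noteq> 0" "q\<^sup>2 = p" "norm p < 1" "p \<noteq> 0"
    using norm_nome[OF \<tau>] by (simp_all add: p_def q_def)
  have s: "(1 / q)\<^sup>2 * p = 1" "(- (1 / q))\<^sup>2 * p = 1"
    using q(1) by (simp_all add: q(2) [symmetric] power_divide)
  have prods: "(\<lambda>k. factor_e1 \<tau> z (Suc k)) has_prod theta_quotient p 1 w"
    "(\<lambda>k. factor_e3 \<tau> z (Suc k)) has_prod theta_quotient p (- (1 / q)) w"
    "(\<lambda>k. factor_e2 \<tau> z (Suc k)) has_prod theta_quotient p (1 / q) w"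
    using theta_quotient_has_prod[OF q(3)]
    by (simp_all only: factor_e1_eq factor_e2_eq factor_e3_eq p_def q_def w_def)
  have prod_theta: "(\<lambda>k. factor_e1_theta \<tau> z (Suc k)) has_prod (theta_pair p 1 w / theta_pair p (- 1) w)\<^sup>2"
    using theta_pair_quotient_has_prod[OF q(3)]
    by (simp only: factor_e1_theta_eq p_def w_def)
  have e1: "wp \<tau> z - wp_e1 \<tau> = (of_real pi * cot (of_real pi * z / 2))\<^sup>2 / 4 * theta_quotient p 1 w"
    using wp_minus_e1[OF \<tau> z] by (simp only: cot_prefactor p_def w_def)
  have "theta_quotient p 1 w = (theta3_0 \<tau> * theta4_0 \<tau>)\<^sup>2 * (theta_pair p 1 w / theta_pair p (- 1) w)\<^sup>2"
    using theta_product[OF \<tau>] by (simp add: theta_quotient_def p_def flip: power_mult)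
  hence e1': "wp \<tau> z - wp_e1 \<tau> = (of_real pi * theta3_0 \<tau> * theta4_0 \<tau> * cot (of_real pi * z / 2))\<^sup>2 / 4 *
      (theta_pair p 1 w / theta_pair p (- 1) w)\<^sup>2"
    unfolding e1 by (simp add: power_mult_distrib)
  have e3: "wp \<tau> z - wp_e3 \<tau> = (of_real pi)\<^sup>2 / (2 * sin (of_real pi * z / 2))\<^sup>2 * theta_quotient p (- (1 / q)) w"
    unfolding wp_e3_def csc_prefactor p_def w_def
    by (rule wp_minus_csc_form[OF \<tau> z half_periods_not_in_lattice(1)[OF \<tau>]])
       (use s q in \<open>simp_all add: p_def q_def\<close>)
  have "exp (\<i> * of_real pi * (1 + \<tau>)) = - q"
    by (simp add: distrib_left exp_add q_def)
  hence e2: "wp \<tau> z - wp_e2 \<tau> = (of_real pi)\<^sup>2 / (2 * sin (of_real pi * z / 2))\<^sup>2 * theta_quotient p (1 / q) w"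
    unfolding wp_e2_def csc_prefactor p_def w_def
    by (intro wp_minus_csc_form[OF \<tau> z half_periods_not_in_lattice(2)[OF \<tau>]])
       (use s q in \<open>simp_all add: p_def q_def\<close>)
  show ?thesis
    using prods prod_theta e1 e1' e2 e3 by (simp add: has_prod_iff)
qed

end
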